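(* Let $a\in\mathbb{C}$. (a) If $0<|a|\le \frac{8}{\sqrt6}$, then all eigenvalues of the operators $A(a)$ and $D(a)$ are simple. (b) If $0<|a|\le \frac43$, then all eigenvalues of the operators $P(a)$ and $N(a)$ are simple.
   Context: For $a\in\mathbb{C}$, the operators $P(a)$, $A(a)$, $D(a)$, $N(a)$ act in $L_2[0,\pi]$ and are generated by the differential expression $-y''(x)+(2a\cos 2x)\,y(x)$ together with, respectively, the periodic conditions $y(\pi)=y(0),\ y'(\pi)=y'(0)$; the antiperiodic conditions $y(\pi)=-y(0),\ y'(\pi)=-y'(0)$; the Dirichlet conditions $y(\pi)=y(0)=0$; the Neumann conditions $y'(\pi)=y'(0)=0$. The multiplicity of an eigenvalue is its algebraic multiplicity (the number of linearly independent root functions, i.e. eigenfunctions and associated functions), and an eigenvalue is simple if its algebraic multiplicity is $1$. *)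

theory Defs
  imports "HOL-Analysis.Analysis" "HOL-Library.Function_Algebras"
begin

global_interpretation cfun:
  vector_space "\<lambda>(c::complex) (f :: real \<Rightarrow> complex) x. c * f x"
  by unfold_locales (auto simp: fun_eq_iff algebra_simps)

section \<open>Operators generated by a Sturm-Liouville expression on \<open>[0, \<pi>]\<close>\<close>

text \<open>Representatives of the elements of \<open>L\<^sub>2[0, \<pi>]\<close>.\<close>

definition L2 :: "(real \<Rightarrow> complex) set" where
  "L2 = {f. f \<in> borel_measurable (lebesgue_on {0..pi}) \<and>
            integrable (lebesgue_on {0..pi}) (\<lambda>x. (cmod (f x))\<^sup>2)}"

abbreviation deriv0pi :: "(real \<Rightarrow> complex) \<Rightarrow> real \<Rightarrow> complex" where
  "deriv0pi y x \<equiv> vector_derivative y (at x within {0..pi})"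

text \<open>\<open>has_second_deriv y v\<close>: \<open>y\<close> is differentiable on \<open>[0, \<pi>]\<close>, \<open>y'\<close> is absolutely
  continuous there, and \<open>y'' = v\<close> almost everywhere, where \<open>v\<close> lies in \<open>L\<^sub>2[0, \<pi>]\<close>. Absolute
  continuity is expressed by writing \<open>y'\<close> as an indefinite Lebesgue integral.\<close>

definition has_second_deriv :: "(real \<Rightarrow> complex) \<Rightarrow> (real \<Rightarrow> complex) \<Rightarrow> bool" where
  "has_second_deriv y v \<longleftrightarrow>
     (\<forall>x\<in>{0..pi}. y differentiable (at x within {0..pi})) \<and>
     v \<in> L2 \<and>
     (\<forall>x\<in>{0..pi}. deriv0pi y x = deriv0pi y 0 + (LINT t:{0..x}|lebesgue. v t))"

text \<open>A boundary condition is a predicate of \<open>y\<close> and \<open>y'\<close>.\<close>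

type_synonym boundary_condition = "(real \<Rightarrow> complex) \<Rightarrow> (real \<Rightarrow> complex) \<Rightarrow> bool"

definition periodic_bc :: boundary_condition where
  "periodic_bc y y' \<longleftrightarrow> y pi = y 0 \<and> y' pi = y' 0"

definition antiperiodic_bc :: boundary_condition where
  "antiperiodic_bc y y' \<longleftrightarrow> y pi = - y 0 \<and> y' pi = - y' 0"

definition dirichlet_bc :: boundary_condition where
  "dirichlet_bc y y' \<longleftrightarrow> y pi = 0 \<and> y 0 = 0"

definition neumann_bc :: boundary_condition where
  "neumann_bc y y' \<longleftrightarrow> y' pi = 0 \<and> y' 0 = 0"

text \<open>The graph of the operator generated in \<open>L\<^sub>2[0, \<pi>]\<close> by \<open>-y'' + q y\<close> and the boundary
  condition \<open>B\<close>. The class of an element of the domain has exactly one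
  continuous representative on \<open>[0, \<pi>]\<close>; extending it by \<open>0\<close> to the real line makes \<open>y\<close> a unique
  function. The image \<open>f\<close> is an arbitrary representative of its class, so equality with \<open>f\<close>
  holds only almost everywhere.\<close>

type_synonym operator_graph = "((real \<Rightarrow> complex) \<times> (real \<Rightarrow> complex)) set"

definition sl_operator :: "(real \<Rightarrow> complex) \<Rightarrow> boundary_condition \<Rightarrow> operator_graph" where
  "sl_operator q B =
     {(y, f). (\<forall>x. x \<notin> {0..pi} \<longrightarrow> y x = 0) \<and> B y (deriv0pi y) \<and> f \<in> L2 \<and>
        (\<exists>v. has_second_deriv y v \<and>
             (AE x in lebesgue_on {0..pi}. f x = - v x + q x * y x))}"


section \<open>Eigenvalues, root functions, algebraic multiplicity\<close>

definition eigenvalue :: "operator_graph \<Rightarrow> complex \<Rightarrow> bool" where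
  "eigenvalue T \<mu> \<longleftrightarrow> (\<exists>y. y \<noteq> (\<lambda>_. 0) \<and> (y, \<lambda>x. \<mu> * y x) \<in> T)"

text \<open>\<open>root_space T \<mu> n\<close> is the kernel of \<open>(T - \<mu>)\<^sup>n\<close>: the condition
  \<open>(y, \<mu> y + z) \<in> T\<close> says that \<open>(T - \<mu>) y = z\<close>.\<close>

primrec root_space :: "operator_graph \<Rightarrow> complex \<Rightarrow> nat \<Rightarrow> (real \<Rightarrow> complex) set" where
  "root_space T \<mu> 0 = {\<lambda>_. 0}"
| "root_space T \<mu> (Suc n) =
     {y. \<exists>z \<in> root_space T \<mu> n. (y, \<lambda>x. \<mu> * y x + z x) \<in> T}"

text \<open>The maximal number of linearly independent root functions. By the convention for \<open>dim\<close>
  the value is \<open>0\<close> if that number is infinite, so multiplicity \<open>1\<close> always means a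
  one-dimensional space of root functions.\<close>

definition alg_multiplicity :: "operator_graph \<Rightarrow> complex \<Rightarrow> nat" where
  "alg_multiplicity T \<mu> = cfun.dim (\<Union>n. root_space T \<mu> n)"

definition simple_eigenvalue :: "operator_graph \<Rightarrow> complex \<Rightarrow> bool" where
  "simple_eigenvalue T \<mu> \<longleftrightarrow> eigenvalue T \<mu> \<and> alg_multiplicity T \<mu> = 1"


section \<open>The Mathieu operators\<close>

definition mathieu_potential :: "complex \<Rightarrow> real \<Rightarrow> complex" where
  "mathieu_potential a x = 2 * a * complex_of_real (cos (2 * x))"

definition P_op :: "complex \<Rightarrow> operator_graph" where
  "P_op a = sl_operator (mathieu_potential a) periodic_bc"

definition A_op :: "complex \<Rightarrow> operator_graph" where
  "A_op a = sl_operator (mathieu_potential a) antiperiodic_bc"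

definition D_op :: "complex \<Rightarrow> operator_graph" where
  "D_op a = sl_operator (mathieu_potential a) dirichlet_bc"

definition N_op :: "complex \<Rightarrow> operator_graph" where
  "N_op a = sl_operator (mathieu_potential a) neumann_bc"

end

theory Submission
  imports Defs
begin

text \<open>
  By symmetry of the bilinear form \<open>\<integral> y z\<close>, an eigenvalue with one-dimensional eigenspace spanned by
  \<open>y\<close> can fail to be simple only if \<open>\<integral> y\<^sup>2 = 0\<close>. Reflection at \<open>\<pi> / 2\<close> splits periodic and antiperiodic
  eigenfunctions into Dirichlet and Neumann ones, and Ince's theorem excludes that both kinds occur
  for the same eigenvalue, so all eigenspaces are one-dimensional. The Fourier coefficients of an
  eigenfunction satisfy a three-term recurrence \<open>(l\<^sub>j - \<mu>) c\<^sub>j + a (c\<^sub>j\<^sub>-\<^sub>1 + c\<^sub>j\<^sub>+\<^sub>1) = 0\<close>, and \<open>\<integral> y\<^sup>2 = 0\<close>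
  says that their weighted squares sum to zero. This cancellation is impossible: if \<open>Re \<mu>\<close>
  is to the right of the midpoint of \<open>l\<^sub>1\<close> and \<open>l\<^sub>2\<close>, one coefficient dominates all the others; otherwise
  \<open>c\<^sub>0\<close> and \<open>c\<^sub>1\<close> dominate, hence \<open>c\<^sub>0\<^sup>2 \<approx> -\<gamma> c\<^sub>1\<^sup>2\<close>, and the first two rows of the
  recurrence force \<open>\<bar>a\<bar>\<close> above the stated bound.
\<close>

section \<open>Cancellation of squares in three-term recurrences\<close>

text \<open>For complex \<open>a\<close> the squares have no sign, so their cancellation can only be
  refuted by size. The delicate case is the one with two comparable coefficients, and two devices
  keep its estimate small enough. One is a second pass: the crude ratio 44/100 for
  \<open>c 2 / c 1\<close> serves only to show that \<mu> lies near the midpoint of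
  \<open>l 0\<close> and \<open>l 1\<close>; from there \<open>l 2\<close> is so far away that the
  ratio is at most \<open>r\<close>. The other is that the main terms, \<beta> (real) and
  \<open>2 * \<i> * sqrt \<gamma>\<close> (imaginary up to sign), add at right angles, giving
  \<open>sqrt (\<beta>\<^sup>2 + 4 * \<gamma>)\<close>. For odd frequencies
  \<open>l 1 - l 0 = 8\<close> and \<beta> is 1 or -1, \<gamma> = 1: \<open>sqrt 5\<close> plus the
  errors stays below \<open>sqrt 6\<close>, which admits \<open>8 / sqrt 6\<close>. For even cosines
  \<open>l 1 - l 0 = 4\<close>, \<beta> = 0, \<gamma> = 2: \<open>sqrt 8\<close> plus the errors
  stays below 3, which admits \<open>4 / 3\<close>. Only \<open>P_op\<close> and \<open>N_op\<close>
  involve even cosines, hence their smaller bound.\<close>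

text \<open>A diagonal of size at least \<open>2 * A\<close> makes \<open>u\<close> convex from
  \<open>N\<close> on: one increase would be followed by increases forever, against the limit
  0.\<close>

lemma three_term_decreasing:
  fixes u d :: "nat \<Rightarrow> real"
  assumes nonneg: "\<And>j. 0 \<le> u j" and lim: "u \<longlonglongrightarrow> 0" and A: "0 < A"
    and rec: "\<And>j. j \<ge> N \<Longrightarrow> d j * u (Suc j) \<le> A * (u j + u (Suc (Suc j)))"
    and big: "\<And>j. j \<ge> N \<Longrightarrow> 2 * A \<le> d j"
    and m: "m \<ge> N"
  shows "u (Suc m) \<le> u m"
proof (rule ccontr)
  assume "\<not> u (Suc m) \<le> u m"
  then have gt: "u m < u (Suc m)" by simp
  have step: "u (Suc j) < u (Suc (Suc j))" if "j \<ge> N" "u j < u (Suc j)" for j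
  proof -
    have "2 * A * u (Suc j) \<le> d j * u (Suc j)"
      using big[OF that(1)] nonneg by (intro mult_right_mono) auto
    also have "\<dots> \<le> A * (u j + u (Suc (Suc j)))" using rec[OF that(1)] .
    finally have "A * (2 * u (Suc j)) \<le> A * (u j + u (Suc (Suc j)))"
      by (simp add: algebra_simps)
    then have "2 * u (Suc j) \<le> u j + u (Suc (Suc j))" using A by simp
    then show ?thesis using that(2) by linarith
  qed
  have inc: "u (m + i) < u (Suc (m + i))" for i
    by (induction i) (use gt step m in auto)
  have ge: "u (Suc m) \<le> u (Suc m + i)" for i
  proof (induction i)
    case (Suc i)
    then show ?case using inc[of "Suc i"] by simp
  qed simp
  have "(\<lambda>i. u (i + Suc m)) \<longlonglongrightarrow> 0" using lim by (rule LIMSEQ_ignore_initial_segment)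
  then have "u (Suc m) \<le> 0"
    by (rule LIMSEQ_le_const) (use ge in \<open>auto simp: add.commute intro!: exI[of _ 0]\<close>)
  then show False using gt nonneg[of m] by linarith
qed

lemma geometric_tail_sum:
  fixes u :: "nat \<Rightarrow> real"
  assumes nonneg: "\<And>j. 0 \<le> u j" and half: "\<And>j. u (Suc j) \<le> u j / 2"
  shows "summable (\<lambda>j. (u j)\<^sup>2)" and "(\<Sum>j. (u j)\<^sup>2) \<le> 4 / 3 * (u 0)\<^sup>2"
proof -
  have pw: "u j \<le> u 0 * (1/2) ^ j" for j
    by (induction j) (use half in \<open>auto intro: order_trans\<close>)
  have sq: "(u j)\<^sup>2 \<le> (u 0)\<^sup>2 * (1/4) ^ j" for j
  proof -
    have "(u j)\<^sup>2 \<le> (u 0 * (1/2) ^ j)\<^sup>2" using pw nonneg by (intro power_mono) auto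
    also have "\<dots> = (u 0)\<^sup>2 * (1/4) ^ j"
      by (simp add: power_mult_distrib power2_eq_square power_divide flip: power_mult_distrib)
    finally show ?thesis .
  qed
  have s: "(\<lambda>j. (u 0)\<^sup>2 * (1/4) ^ j) sums ((u 0)\<^sup>2 * (1 / (1 - 1/4)))"
    by (intro sums_mult geometric_sums) auto
  show sm: "summable (\<lambda>j. (u j)\<^sup>2)"
    by (rule summable_comparison_test[OF _ sums_summable[OF s]]) (use sq in auto)
  have "(\<Sum>j. (u j)\<^sup>2) \<le> (\<Sum>j. (u 0)\<^sup>2 * (1/4) ^ j)"
    using sq sm sums_summable[OF s] by (rule suminf_le)
  also have "\<dots> = 4 / 3 * (u 0)\<^sup>2" using sums_unique[OF s] by simp
  finally show "(\<Sum>j. (u j)\<^sup>2) \<le> 4 / 3 * (u 0)\<^sup>2" .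
qed

lemma geometric_head_sum:
  fixes u :: "nat \<Rightarrow> real"
  assumes nonneg: "\<And>j. 0 \<le> u j" and half: "\<And>j. j < m \<Longrightarrow> u j \<le> u (Suc j) / 2"
  shows "(\<Sum>j\<le>m. (u j)\<^sup>2) \<le> 4 / 3 * (u m)\<^sup>2"
  using half
proof (induction m)
  case 0
  then show ?case by simp
next
  case (Suc m)
  then have "(\<Sum>j\<le>m. (u j)\<^sup>2) \<le> 4 / 3 * (u m)\<^sup>2" by simp
  also have "\<dots> \<le> 4 / 3 * (u (Suc m) / 2)\<^sup>2"
    using Suc.prems[of m] nonneg by (intro mult_left_mono power_mono) auto
  finally show ?case by (simp add: power_divide)
qed

text \<open>Feeds a bound \<open>s * x\<close> for the far neighbour back into a row of the
  recurrence. The ratios 16/100, 44/100 and 52/100 used later are \<open>r / (p - r * s)\<close>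
  rounded up.\<close>

lemma absorb_right:
  fixes x y p q r s :: real
  assumes "p * x \<le> r * (y + s * x)" "r * s < p" "r \<le> q * (p - r * s)" "0 \<le> y"
  shows "x \<le> q * y"
proof -
  have "(p - r * s) * x \<le> r * y" using assms(1) by (simp add: algebra_simps)
  also have "\<dots> \<le> q * (p - r * s) * y" using assms by (intro mult_right_mono)
  finally have "(p - r * s) * x \<le> (p - r * s) * (q * y)" by (simp add: algebra_simps)
  then show ?thesis using assms(2) by simp
qed

text \<open>The shape shared by the Fourier coefficient sequences of all four problems. The pair
  \<open>(\<beta>, \<gamma>)\<close> records the reflection at frequency \<open>0\<close>; \<open>r\<close> is an upper bound for \<open>\<bar>c 2 / c 1\<bar>\<close> in the
  case that \<open>\<mu>\<close> lies near \<open>l 0\<close> and \<open>l 1\<close>. The numerical constants leave just enough room for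
  \<open>\<bar>a\<bar> = 8 / \<surd>6\<close>.\<close>

locale mathieu_coeffs =
  fixes a \<mu> :: complex and \<beta> \<gamma> h r :: real and l :: "nat \<Rightarrow> real" and c :: "nat \<Rightarrow> complex"
  assumes a0: "a \<noteq> 0"
    and row0: "(of_real (l 0) - \<mu> + of_real \<beta> * a) * c 0 + of_real \<gamma> * a * c 1 = 0"
    and row: "\<And>j. (of_real (l (Suc j)) - \<mu>) * c (Suc j) + a * (c j + c (Suc (Suc j))) = 0"
    and lim: "c \<longlonglongrightarrow> 0"
    and h: "0 < h" and gap: "\<And>j. j \<ge> 1 \<Longrightarrow> l j + 2 * h \<le> l (Suc j)"
    and a_h: "cmod a \<le> 41/100 * h" and \<gamma>: "1 \<le> \<gamma>"
    and gap0: "(\<bar>\<beta>\<bar> + 2 * \<gamma>) * cmod a \<le> l 1 - l 0 + h"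
    and r: "0 < r" "r \<le> 205/1000"
    and near_dist: "cmod a + r * (cmod a * (\<bar>\<beta>\<bar> + 44/100 + 31/100 * sqrt \<gamma>) / 2 + 16/100 * cmod a)
      \<le> r * (l 2 - (l 0 + l 1) / 2)"
    and near_gap: "cmod a * (sqrt (\<beta>\<^sup>2 + 4 * \<gamma>) + 2/1000 * sqrt \<gamma> + r) < l 1 - l 0"
    and isotropic: "(\<lambda>j. (c (Suc j))\<^sup>2) sums (- (c 0)\<^sup>2 / of_real \<gamma>)"
begin

lemma row_norm:
  "cmod (of_real (l (Suc j)) - \<mu>) * cmod (c (Suc j)) \<le> cmod a * (cmod (c j) + cmod (c (Suc (Suc j))))"
proof -
  have "(of_real (l (Suc j)) - \<mu>) * c (Suc j) = - (a * (c j + c (Suc (Suc j))))"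
    using row[of j] by (simp add: eq_neg_iff_add_eq_0)
  then have "cmod (of_real (l (Suc j)) - \<mu>) * cmod (c (Suc j)) = cmod a * cmod (c j + c (Suc (Suc j)))"
    by (metis norm_minus_cancel norm_mult)
  also have "\<dots> \<le> cmod a * (cmod (c j) + cmod (c (Suc (Suc j))))"
    by (intro mult_left_mono norm_triangle_ineq) auto
  finally show ?thesis .
qed

lemma l_mono: "i \<ge> 1 \<Longrightarrow> i < j \<Longrightarrow> l i + 2 * h \<le> l j"
proof (induction j)
  case (Suc j)
  show ?case
  proof (cases "i = j")
    case False
    then have "l i + 2 * h \<le> l j" using Suc by auto
    also have "\<dots> \<le> l (Suc j)" using gap[of j] Suc h by simp
    finally show ?thesis .
  qed (use gap Suc in auto)
qed simp

lemma a_pos: "0 < cmod a"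
  using a0 by simp

section \<open>Decay of the coefficients to the right of \<open>Re \<mu>\<close>\<close>

context
  fixes k :: nat
  assumes k: "k \<ge> 1" and left_of: "Re \<mu> \<le> (l k + l (Suc k)) / 2"
begin

lemma dist_Suc: "cmod (of_real (l (Suc k)) - \<mu>) \<ge> h"
proof -
  have "h \<le> Re (of_real (l (Suc k)) - \<mu>)" using gap[OF k] left_of by simp
  also have "\<dots> \<le> cmod (of_real (l (Suc k)) - \<mu>)" by (rule complex_Re_le_cmod)
  finally show ?thesis .
qed

lemma dist_tail: "j > Suc k \<Longrightarrow> cmod (of_real (l j) - \<mu>) \<ge> 3 * h"
proof -
  assume "j > Suc k"
  then have "l (Suc k) + 2 * h \<le> l j" by (intro l_mono) auto
  then have "3 * h \<le> Re (of_real (l j) - \<mu>)" using gap[OF k] left_of by simp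
  also have "\<dots> \<le> cmod (of_real (l j) - \<mu>)" by (rule complex_Re_le_cmod)
  finally show ?thesis .
qed

lemma tail_decreasing: "j \<ge> k \<Longrightarrow> cmod (c (Suc j)) \<le> cmod (c j)"
proof (rule three_term_decreasing[where N = k and A = "cmod a" and d = "\<lambda>j. cmod (of_real (l (Suc j)) - \<mu>)"])
  show "(\<lambda>j. cmod (c j)) \<longlonglongrightarrow> 0" using lim by (simp add: tendsto_norm_zero)
  \<comment> \<open>By \<open>a_h\<close>, \<open>2 * cmod a\<close> is at most
    \<open>82/100 * h\<close>, and every distance in the tail is at least \<open>h\<close>.\<close>
  show "2 * cmod a \<le> cmod (of_real (l (Suc j)) - \<mu>)" if "k \<le> j" for j
    using dist_Suc dist_tail[of "Suc j"] that a_h h by (cases "j = k") auto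
qed (use row_norm a_pos in auto)

lemma tail_ratio: "j > k \<Longrightarrow> cmod (c (Suc j)) \<le> 16/100 * cmod (c j)"
proof -
  assume j: "j > k"
  have "3 * h * cmod (c (Suc j)) \<le> cmod (of_real (l (Suc j)) - \<mu>) * cmod (c (Suc j))"
    using dist_tail[of "Suc j"] j by (intro mult_right_mono) auto
  also have "\<dots> \<le> cmod a * (cmod (c j) + cmod (c (Suc (Suc j))))" by (rule row_norm)
  also have "\<dots> \<le> 41/100 * h * (cmod (c j) + cmod (c (Suc j)))"
    using tail_decreasing[of "Suc j"] j a_h h by (intro mult_mono add_mono) auto
  finally have "h * (3 * cmod (c (Suc j))) \<le> h * (41/100 * (cmod (c j) + cmod (c (Suc j))))"
    by (simp add: algebra_simps)
  then have "3 * cmod (c (Suc j)) \<le> 41/100 * (cmod (c j) + 1 * cmod (c (Suc j)))"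
    using h by (simp only: mult_le_cancel_left_pos mult_1)
  then show ?thesis by (rule absorb_right) auto
qed

text \<open>Here only distance \<open>h\<close> is available; the stronger ratio of the next
  coefficient, proved before, is what brings the quotient down to 41/100 / (1 - 41/100 *
  16/100).\<close>

lemma first_ratio: "cmod (c (Suc k)) \<le> 44/100 * cmod (c k)"
proof -
  have "h * cmod (c (Suc k)) \<le> cmod (of_real (l (Suc k)) - \<mu>) * cmod (c (Suc k))"
    using dist_Suc by (intro mult_right_mono) auto
  also have "\<dots> \<le> cmod a * (cmod (c k) + cmod (c (Suc (Suc k))))" by (rule row_norm)
  also have "\<dots> \<le> 41/100 * h * (cmod (c k) + 16/100 * cmod (c (Suc k)))"
    using tail_ratio[of "Suc k"] a_h h by (intro mult_mono add_mono) auto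
  finally have "h * (cmod (c (Suc k))) \<le> h * (41/100 * (cmod (c k) + 16/100 * cmod (c (Suc k))))"
    by (simp add: algebra_simps)
  then have "1 * cmod (c (Suc k)) \<le> 41/100 * (cmod (c k) + 16/100 * cmod (c (Suc k)))"
    using h by (simp only: mult_le_cancel_left_pos mult_1)
  then show ?thesis by (rule absorb_right) auto
qed

lemma tail_sum:
  shows "summable (\<lambda>j. (cmod (c (j + Suc k)))\<^sup>2)"
    and "(\<Sum>j. (cmod (c (j + Suc k)))\<^sup>2) \<le> 4 / 3 * (cmod (c (Suc k)))\<^sup>2"
proof -
  have *: "cmod (c (Suc j + Suc k)) \<le> cmod (c (j + Suc k)) / 2" for j
    using tail_ratio[of "j + Suc k"] norm_ge_zero[of "c (j + Suc k)"] unfolding add_Suc by linarith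
  show "summable (\<lambda>j. (cmod (c (j + Suc k)))\<^sup>2)"
    using geometric_tail_sum(1)[of "\<lambda>j. cmod (c (j + Suc k))", OF _ *] by auto
  show "(\<Sum>j. (cmod (c (j + Suc k)))\<^sup>2) \<le> 4 / 3 * (cmod (c (Suc k)))\<^sup>2"
    using geometric_tail_sum(2)[of "\<lambda>j. cmod (c (j + Suc k))", OF _ *] by auto
qed

lemma tail_zero: "c k = 0 \<Longrightarrow> j \<ge> k \<Longrightarrow> c j = 0"
proof (induction j)
  case (Suc j)
  then show ?case using tail_decreasing[of j] by (cases "k = Suc j") auto
qed simp

end

text \<open>If \<open>l k\<close> with \<open>k \<ge> 2\<close> is nearest to \<open>Re \<mu>\<close>, then \<open>c k\<close> outweighs all other coefficients
  together, so the squares cannot cancel.\<close>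

lemma dominant:
  assumes k: "k \<ge> 2" and left_of: "Re \<mu> \<le> (l k + l (Suc k)) / 2"
    and right_of: "(l (k - 1) + l k) / 2 \<le> Re \<mu>"
  shows "c j = 0"
proof -
  \<comment> \<open>\<open>Suc m\<close> is the left neighbour of \<open>k\<close>;
    \<open>k \<ge> 2\<close> puts index 0, whose row has a different shape, strictly left of that
    neighbour.\<close>
  define m where "m = k - 2"
  have km: "k = Suc (Suc m)" using k by (simp add: m_def)
  have dR: "cmod (of_real x - \<mu>) \<ge> Re \<mu> - x" for x
  proof -
    have "Re \<mu> - x \<le> \<bar>Re (of_real x - \<mu>)\<bar>" by simp
    also have "\<dots> \<le> cmod (of_real x - \<mu>)" by (rule abs_Re_le_cmod)
    finally show ?thesis .
  qed
  have g: "l (Suc m) + 2 * h \<le> l k" using gap[of "Suc m"] km by simp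
  \<comment> \<open>Since \<open>Re \<mu>\<close> is at least \<open>l 1 + h\<close>,
    \<open>gap0\<close> keeps the diagonal entry of row 0 at size
    \<open>2 * \<gamma> * cmod a\<close> or more, even after the loss of
    \<open>\<beta> * a\<close>.\<close>
  have c0: "cmod (c 0) \<le> cmod (c 1) / 2"
  proof -
    have "l 1 + h \<le> Re \<mu>"
    proof (cases "m = 0")
      case True
      then show ?thesis using right_of g km by simp
    next
      case False
      then have "l 1 + 2 * h \<le> l (Suc m)" by (intro l_mono) auto
      then show ?thesis using right_of g km h by simp
    qed
    then have "l 1 - l 0 + h \<le> cmod (of_real (l 0) - \<mu>)" using dR[of "l 0"] by linarith
    also have "\<dots> \<le> cmod (of_real (l 0) - \<mu> + of_real \<beta> * a) + \<bar>\<beta>\<bar> * cmod a"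
      using norm_triangle_ineq4[of "of_real (l 0) - \<mu> + of_real \<beta> * a" "of_real \<beta> * a"]
      by (simp add: norm_mult)
    finally have "2 * \<gamma> * cmod a \<le> cmod (of_real (l 0) - \<mu> + of_real \<beta> * a)"
      using gap0 by (simp add: algebra_simps)
    then have "2 * \<gamma> * cmod a * cmod (c 0) \<le> cmod ((of_real (l 0) - \<mu> + of_real \<beta> * a) * c 0)"
      by (simp add: norm_mult mult_right_mono)
    also have "(of_real (l 0) - \<mu> + of_real \<beta> * a) * c 0 = - (of_real \<gamma> * a * c 1)"
      using row0 by (simp add: eq_neg_iff_add_eq_0)
    also have "cmod \<dots> = \<gamma> * cmod a * cmod (c 1)" using \<gamma> by (simp add: norm_mult)
    finally have "\<gamma> * cmod a * (2 * cmod (c 0)) \<le> \<gamma> * cmod a * cmod (c 1)" by (simp add: algebra_simps)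
    moreover have "0 < \<gamma> * cmod a" using \<gamma> a_pos by simp
    ultimately show ?thesis by (simp only: mult_le_cancel_left_pos)
  qed
  \<comment> \<open>No limit helps on the left side, so the ratios are built up from index 0, each
    bound entering the next row, which has distance at least \<open>3 * h\<close>.\<close>
  have half: "cmod (c j) \<le> cmod (c (Suc j)) / 2" if "j \<le> m" for j
    using that
  proof (induction j)
    case 0
    then show ?case using c0 by simp
  next
    case (Suc j)
    have "l (Suc j) + 2 * h \<le> l (Suc m)" using Suc.prems by (intro l_mono) auto
    then have "3 * h \<le> cmod (of_real (l (Suc j)) - \<mu>)" using right_of g km dR[of "l (Suc j)"] by simp
    then have "3 * h * cmod (c (Suc j)) \<le> cmod (of_real (l (Suc j)) - \<mu>) * cmod (c (Suc j))"
      by (intro mult_right_mono) auto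
    also have "\<dots> \<le> cmod a * (cmod (c j) + cmod (c (Suc (Suc j))))" by (rule row_norm)
    also have "\<dots> \<le> 41/100 * h * (cmod (c (Suc j)) / 2 + cmod (c (Suc (Suc j))))"
      using Suc a_h h by (intro mult_mono add_mono) auto
    finally have "h * (3 * cmod (c (Suc j))) \<le> h * (41/100 * (cmod (c (Suc j)) / 2 + cmod (c (Suc (Suc j)))))"
      by (simp add: algebra_simps)
    then have "3 * cmod (c (Suc j)) \<le> 41/100 * (cmod (c (Suc (Suc j))) + 1/2 * cmod (c (Suc j)))"
      using h by (simp only: mult_le_cancel_left_pos) simp
    then have "cmod (c (Suc j)) \<le> 1/2 * cmod (c (Suc (Suc j)))" by (rule absorb_right) auto
    then show ?case by simp
  qed
  \<comment> \<open>The row of the left neighbour has only distance \<open>h\<close>, and 41/100 /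
    (1 - 41/200) is below 52/100.\<close>
  have left: "cmod (c (Suc m)) \<le> 52/100 * cmod (c k)"
  proof -
    have "h \<le> cmod (of_real (l (Suc m)) - \<mu>)" using right_of g km dR[of "l (Suc m)"] by simp
    then have "h * cmod (c (Suc m)) \<le> cmod (of_real (l (Suc m)) - \<mu>) * cmod (c (Suc m))"
      by (intro mult_right_mono) auto
    also have "\<dots> \<le> cmod a * (cmod (c m) + cmod (c k))" unfolding km by (rule row_norm)
    also have "\<dots> \<le> 41/100 * h * (cmod (c (Suc m)) / 2 + cmod (c k))"
      using half[of m] a_h h by (intro mult_mono add_mono) auto
    finally have "h * cmod (c (Suc m)) \<le> h * (41/100 * (cmod (c (Suc m)) / 2 + cmod (c k)))"
      by (simp add: algebra_simps)
    then have "1 * cmod (c (Suc m)) \<le> 41/100 * (cmod (c k) + 1/2 * cmod (c (Suc m)))"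
      using h by (simp only: mult_le_cancel_left_pos) simp
    then show ?thesis by (rule absorb_right) auto
  qed
  have k1: "k \<ge> 1" using k by simp
  define H where "H = (\<Sum>j\<le>Suc m. (cmod (c j))\<^sup>2)"
  define T where "T = (\<Sum>j. (cmod (c (j + Suc k)))\<^sup>2)"
  have sm2: "summable (\<lambda>j. (c (j + Suc k))\<^sup>2)"
    by (rule summable_norm_cancel) (use tail_sum(1)[OF k1 left_of] in \<open>simp add: norm_power\<close>)
  have "(\<lambda>j. (c (Suc (j + k)))\<^sup>2) sums (- (c 0)\<^sup>2 / of_real \<gamma> - (\<Sum>j<k. (c (Suc j))\<^sup>2))"
    using isotropic sums_iff_shift[of "\<lambda>j. (c (Suc j))\<^sup>2" k] by simp
  then have "(\<Sum>j. (c (j + Suc k))\<^sup>2) = - (c 0)\<^sup>2 / of_real \<gamma> - (\<Sum>j<k. (c (Suc j))\<^sup>2)"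
    by (simp add: sums_iff)
  moreover have "(\<Sum>j<k. (c (Suc j))\<^sup>2) = (\<Sum>j<Suc m. (c (Suc j))\<^sup>2) + (c k)\<^sup>2"
    unfolding km by simp
  \<comment> \<open>Isotropy, solved for the square that is to dominate.\<close>
  ultimately have ck: "(c k)\<^sup>2 = - ((c 0)\<^sup>2 / of_real \<gamma> + (\<Sum>j<Suc m. (c (Suc j))\<^sup>2) + (\<Sum>j. (c (j + Suc k))\<^sup>2))"
    by simp
  have "(cmod (c k))\<^sup>2 = cmod ((c 0)\<^sup>2 / of_real \<gamma> + (\<Sum>j<Suc m. (c (Suc j))\<^sup>2) + (\<Sum>j. (c (j + Suc k))\<^sup>2))"
    using arg_cong[OF ck, of cmod] by (metis norm_minus_cancel norm_power)
  also have "\<dots> \<le> cmod ((c 0)\<^sup>2 / of_real \<gamma>) + cmod (\<Sum>j<Suc m. (c (Suc j))\<^sup>2) + cmod (\<Sum>j. (c (j + Suc k))\<^sup>2)"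
    using norm_triangle_ineq order_trans add_right_mono by meson
  also have "\<dots> \<le> (cmod (c 0))\<^sup>2 + (\<Sum>j<Suc m. (cmod (c (Suc j)))\<^sup>2) + T"
  proof (intro add_mono)
    have "(cmod (c 0))\<^sup>2 / \<gamma> \<le> (cmod (c 0))\<^sup>2 / 1" using \<gamma> by (intro divide_left_mono) auto
    then show "cmod ((c 0)\<^sup>2 / of_real \<gamma>) \<le> (cmod (c 0))\<^sup>2"
      using \<gamma> by (simp add: norm_divide norm_power)
    show "cmod (\<Sum>j<Suc m. (c (Suc j))\<^sup>2) \<le> (\<Sum>j<Suc m. (cmod (c (Suc j)))\<^sup>2)"
      using norm_sum[of "\<lambda>j. (c (Suc j))\<^sup>2" "{..<Suc m}"] by (simp add: norm_power)
    show "cmod (\<Sum>j. (c (j + Suc k))\<^sup>2) \<le> T"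
      unfolding T_def using summable_norm[of "\<lambda>j. (c (j + Suc k))\<^sup>2"] tail_sum(1)[OF k1 left_of]
      by (simp add: norm_power)
  qed
  also have "(cmod (c 0))\<^sup>2 + (\<Sum>j<Suc m. (cmod (c (Suc j)))\<^sup>2) = H"
    unfolding H_def by (subst sum.atMost_shift) simp
  also have "H \<le> 4/3 * (cmod (c (Suc m)))\<^sup>2"
    unfolding H_def by (rule geometric_head_sum) (use half in auto)
  also have "\<dots> \<le> 4/3 * (52/100 * cmod (c k))\<^sup>2"
    using left by (intro mult_left_mono power_mono) auto
  also have "T \<le> 4/3 * (cmod (c (Suc k)))\<^sup>2"
    unfolding T_def by (rule tail_sum(2)[OF k1 left_of])
  also have "\<dots> \<le> 4/3 * (44/100 * cmod (c k))\<^sup>2"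
    using first_ratio[OF k1 left_of] by (intro mult_left_mono power_mono) auto
  finally have "(cmod (c k))\<^sup>2 \<le> 4/3 * (52/100)\<^sup>2 * (cmod (c k))\<^sup>2 + 4/3 * (44/100)\<^sup>2 * (cmod (c k))\<^sup>2"
    by (simp only: power_mult_distrib mult.assoc)
  \<comment> \<open>The factor \<open>4/3 * ((52/100)\<^sup>2 + (44/100)\<^sup>2)\<close> is about
    0.62, hence below 1.\<close>
  then have "(cmod (c k))\<^sup>2 \<le> 0" by (simp add: power2_eq_square)
  then have ck0: "c k = 0" by simp
  then have "c (Suc m) = 0" using left by simp
  \<comment> \<open>The zero spreads to the left through \<open>half\<close>; to the right
    \<open>tail_zero\<close> does the same.\<close>
  have "c (Suc m - i) = 0" if "i \<le> Suc m" for i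
    using that
  proof (induction i)
    case (Suc i)
    then show ?case using half[of "m - i"] by (simp add: Suc_diff_le)
  qed (use \<open>c (Suc m) = 0\<close> in simp)
  from this[of "Suc m - j"] have "j \<le> Suc m \<Longrightarrow> c j = 0" by simp
  then show ?thesis using tail_zero[OF k1 left_of ck0, of j] km by (cases "j \<le> Suc m") auto
qed

text \<open>With \<open>x = c 0 / c 1\<close> and \<open>\<rho> = c 2 / c 1\<close> the first two rows give
  \<open>l 1 - l 0 = a (\<gamma> / x - x + \<beta> - \<rho>)\<close>. Isotropy forces \<open>x\<^sup>2 \<approx> -\<gamma>\<close>, so \<open>\<gamma> / x - x \<approx> \<plusminus>2\<i>\<surd>\<gamma>\<close>,
  and the right-hand side is too small.\<close>

lemma near:
  assumes left_of: "Re \<mu> \<le> (l 1 + l 2) / 2"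
  shows "c j = 0"
proof -
  have L: "Re \<mu> \<le> (l 1 + l (Suc 1)) / 2" using left_of by (simp add: numeral_2_eq_2)
  have sm: "summable (\<lambda>j. (cmod (c (Suc (Suc j))))\<^sup>2)"
    and sb: "(\<Sum>j. (cmod (c (Suc (Suc j))))\<^sup>2) \<le> 4/3 * (cmod (c 2))\<^sup>2"
    using tail_sum[OF _ L] by (simp_all add: numeral_2_eq_2)
  define T where "T = (\<Sum>j. (c (Suc (Suc j)))\<^sup>2)"
  have T: "cmod T \<le> 4/3 * (cmod (c 2))\<^sup>2"
    unfolding T_def using summable_norm[of "\<lambda>j. (c (Suc (Suc j)))\<^sup>2"] sm sb by (simp add: norm_power)
  have "(\<lambda>j. (c (Suc (Suc j)))\<^sup>2) sums (- (c 0)\<^sup>2 / of_real \<gamma> - (c 1)\<^sup>2)"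
    using isotropic by (subst sums_Suc_iff) simp
  then have T_eq: "T = - (c 0)\<^sup>2 / of_real \<gamma> - (c 1)\<^sup>2" unfolding T_def by (simp add: sums_iff)
  have \<gamma>0: "complex_of_real \<gamma> \<noteq> 0" using \<gamma> by auto
  have sq\<gamma>: "sqrt \<gamma> > 0" using \<gamma> by simp
  have "c 1 = 0"
  proof (rule ccontr)
    assume c1: "c 1 \<noteq> 0"
    define x where "x = c 0 / c 1"
    define \<rho> where "\<rho> = c 2 / c 1"
    define \<delta> where "\<delta> = T / (c 1)\<^sup>2"
    have c0: "c 0 = x * c 1" and c2: "c 2 = \<rho> * c 1" using c1 by (simp_all add: x_def \<rho>_def)
    have \<delta>_le: "cmod \<delta> \<le> 4/3 * (cmod \<rho>)\<^sup>2"
      using T c1 by (simp add: \<delta>_def \<rho>_def norm_divide norm_power power_divide divide_right_mono field_simps)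
    have "\<delta> = - x\<^sup>2 / of_real \<gamma> - 1"
      using c1 by (simp add: \<delta>_def T_eq c0 power_mult_distrib field_simps)
    then have x2: "x\<^sup>2 = - of_real \<gamma> * (1 + \<delta>)" using \<gamma>0 by (simp add: field_simps)
    have "((of_real (l 0) - \<mu> + of_real \<beta> * a) * x + of_real \<gamma> * a) * c 1 = 0"
      using row0 by (simp add: c0 algebra_simps)
    then have r0: "(of_real (l 0) - \<mu> + of_real \<beta> * a) * x + of_real \<gamma> * a = 0" using c1 by simp
    have "(of_real (l 1) - \<mu> + a * (x + \<rho>)) * c 1 = 0"
      using row[of 0] by (simp add: c0 c2 algebra_simps flip: numeral_2_eq_2)
    then have r1: "of_real (l 1) - \<mu> + a * (x + \<rho>) = 0" using c1 by simp
    \<comment> \<open>First pass: the crude ratio leaves \<delta> as large as a quarter, too much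
      for the final estimate but enough to locate \<mu>.\<close>
    have \<rho>0: "cmod \<rho> \<le> 44/100"
      using first_ratio[OF _ L] c1 by (simp add: \<rho>_def norm_divide field_simps flip: numeral_2_eq_2)
    have "(cmod \<rho>)\<^sup>2 \<le> (44/100)\<^sup>2" using \<rho>0 by (intro power_mono) auto
    then have \<delta>0: "cmod \<delta> \<le> 2582/10000" using \<delta>_le by (simp add: power2_eq_square)
    have "1 - cmod \<delta> \<le> cmod (1 + \<delta>)" using norm_diff_ineq[of 1 \<delta>] by simp
    then have \<delta>1: "cmod (1 + \<delta>) \<ge> 1 - cmod \<delta>" .
    have nx: "cmod x \<ge> 86/100 * sqrt \<gamma>"
    proof (rule power2_le_imp_le)
      have "(86/100 * sqrt \<gamma>)\<^sup>2 = \<gamma> * (86/100)\<^sup>2" using \<gamma> by (simp add: power_mult_distrib power_divide)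
      also have "\<dots> \<le> \<gamma> * cmod (1 + \<delta>)" using \<gamma> \<delta>0 \<delta>1 by (intro mult_left_mono) (auto simp: power2_eq_square)
      also have "\<dots> = (cmod x)\<^sup>2" using x2 \<gamma> by (metis abs_of_nonneg norm_minus_cancel norm_mult norm_of_real norm_power order_trans zero_le_one)
      finally show "(86/100 * sqrt \<gamma>)\<^sup>2 \<le> (cmod x)\<^sup>2" .
    qed simp
    then have x0: "x \<noteq> 0" using sq\<gamma> by auto
    have r0': "of_real (l 0) - \<mu> + of_real \<beta> * a = - of_real \<gamma> * a / x"
      using r0 x0 by (simp add: field_simps eq_neg_iff_add_eq_0)
    have e0: "\<mu> - of_real (l 0) = of_real \<beta> * a + a * (of_real \<gamma> / x)"
      using r0' by (simp add: algebra_simps)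
    have e1: "\<mu> - of_real (l 1) = a * (x + \<rho>)" using r1 by (simp add: algebra_simps)
    \<comment> \<open>Adding the two rows: \<open>\<gamma> / x + x\<close> almost cancels because
      \<open>x\<^sup>2\<close> is near \<open>- \<gamma>\<close>, so \<mu> is near the midpoint of
      \<open>l 0\<close> and \<open>l 1\<close>.\<close>
    have mean: "2 * (\<mu> - of_real ((l 0 + l 1) / 2)) = a * (of_real \<beta> + \<rho> - of_real \<gamma> * \<delta> / x)"
    proof -
      have "of_real \<gamma> / x + x = (of_real \<gamma> + x\<^sup>2) / x" using x0 by (simp add: field_simps power2_eq_square)
      also have "\<dots> = - of_real \<gamma> * \<delta> / x" by (simp add: x2 algebra_simps)
      finally have *: "a * (of_real \<gamma> / x) + a * x = a * (- of_real \<gamma> * \<delta> / x)" by (metis distrib_left)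
      have "2 * (\<mu> - of_real ((l 0 + l 1) / 2)) = (\<mu> - of_real (l 0)) + (\<mu> - of_real (l 1))"
        by (simp add: field_simps)
      also have "\<dots> = of_real \<beta> * a + (a * (of_real \<gamma> / x) + a * x) + a * \<rho>"
        unfolding e0 e1 by (simp add: algebra_simps)
      also have "\<dots> = a * (of_real \<beta> + \<rho> - of_real \<gamma> * \<delta> / x)" unfolding * by (simp add: algebra_simps)
      finally show ?thesis .
    qed
    have "cmod (of_real \<gamma> * \<delta> / x) \<le> 31/100 * sqrt \<gamma>"
    proof -
      have "cmod (of_real \<gamma> * \<delta> / x) = \<gamma> * cmod \<delta> / cmod x" using \<gamma> by (simp add: norm_mult norm_divide)
      also have "\<dots> \<le> \<gamma> * (2582/10000) / (86/100 * sqrt \<gamma>)"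
        using nx \<delta>0 \<gamma> sq\<gamma> by (intro frac_le mult_left_mono) auto
      also have "\<dots> = sqrt \<gamma> * (2582/8600)"
        using \<gamma> sq\<gamma> by (simp add: field_simps flip: power2_eq_square)
      also have "\<dots> \<le> 31/100 * sqrt \<gamma>" using sq\<gamma> by simp
      finally show ?thesis .
    qed
    then have "cmod (of_real \<beta> + \<rho> - of_real \<gamma> * \<delta> / x) \<le> \<bar>\<beta>\<bar> + 44/100 + 31/100 * sqrt \<gamma>"
      using norm_triangle_ineq4[of "of_real \<beta> + \<rho>" "of_real \<gamma> * \<delta> / x"]
        norm_triangle_ineq[of "of_real \<beta>" \<rho>] \<rho>0 by simp
    then have "cmod (2 * (\<mu> - of_real ((l 0 + l 1) / 2))) \<le> cmod a * (\<bar>\<beta>\<bar> + 44/100 + 31/100 * sqrt \<gamma>)"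
      unfolding mean norm_mult by (intro mult_left_mono) auto
    then have \<mu>_near: "cmod (\<mu> - of_real ((l 0 + l 1) / 2)) \<le> cmod a * (\<bar>\<beta>\<bar> + 44/100 + 31/100 * sqrt \<gamma>) / 2"
      by (simp only: norm_mult) simp
    \<comment> \<open>Second pass: \<open>M\<close> bounds the distance of \<mu> from that midpoint,
      hence \<open>l 2\<close> is at least \<open>l 2 - (l 0 + l 1) / 2 - M\<close> away from \<mu>.
      By \<open>near_dist\<close> the row of \<open>c 2\<close> then gives
      \<open>cmod \<rho> \<le> r\<close>.\<close>
    define M where "M = cmod a * (\<bar>\<beta>\<bar> + 44/100 + 31/100 * sqrt \<gamma>) / 2"
    define d where "d = cmod (of_real (l 2) - \<mu>)"
    have "l 2 - (l 0 + l 1) / 2 \<le> cmod (of_real (l 2 - (l 0 + l 1) / 2))"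
      by (simp only: norm_of_real)
    also have "\<dots> \<le> d + cmod (\<mu> - of_real ((l 0 + l 1) / 2))"
      unfolding d_def using norm_triangle_ineq[of "of_real (l 2) - \<mu>" "\<mu> - of_real ((l 0 + l 1) / 2)"] by simp
    finally have "l 2 - (l 0 + l 1) / 2 \<le> d + M" using \<mu>_near unfolding M_def by linarith
    then have "r * (l 2 - (l 0 + l 1) / 2) \<le> r * (d + M)" using r(1) by (intro mult_left_mono) auto
    with near_dist have "cmod a + r * (M + 16/100 * cmod a) \<le> r * (d + M)" unfolding M_def by (rule order_trans)
    then have d: "cmod a \<le> r * (d - 16/100 * cmod a)" by (simp add: algebra_simps)
    have "d * cmod (c 2) \<le> cmod a * (cmod (c 1) + cmod (c (Suc 2)))"
      using row_norm[of 1] by (simp add: d_def numeral_2_eq_2)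
    also have "\<dots> \<le> cmod a * (cmod (c 1) + 16/100 * cmod (c 2))"
      using tail_ratio[OF _ L, of 2] by (intro mult_left_mono add_mono) auto
    finally have "(d - 16/100 * cmod a) * cmod \<rho> * cmod (c 1) \<le> cmod a * cmod (c 1)"
      by (simp add: c2 norm_mult algebra_simps)
    then have "(d - 16/100 * cmod a) * cmod \<rho> \<le> cmod a" using c1 by simp
    also note d
    finally have "(d - 16/100 * cmod a) * cmod \<rho> \<le> (d - 16/100 * cmod a) * r" by (simp add: mult.commute)
    moreover have "0 < d - 16/100 * cmod a" by (rule zero_less_mult_pos[OF less_le_trans[OF a_pos d] r(1)])
    ultimately have \<rho>1: "cmod \<rho> \<le> r" by (simp only: mult_le_cancel_left_pos)
    then have "(cmod \<rho>)\<^sup>2 \<le> (205/1000)\<^sup>2" using r(2) by (intro power_mono) auto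
    then have \<delta>2: "cmod \<delta> \<le> 57/1000" using \<delta>_le by (simp add: power2_eq_square)
    define s where "s = complex_of_real (sqrt \<gamma>)"
    \<comment> \<open>In this normalisation the error \<open>w\<^sup>2 + 4\<close> equals
      \<open>- \<delta>\<^sup>2 / (1 + \<delta>)\<close>: it is of second order in \<delta>, hence
      tiny.\<close>
    define w where "w = (of_real \<gamma> / x - x) / s"
    have s2: "s\<^sup>2 = of_real \<gamma>" using \<gamma> by (simp add: s_def flip: of_real_power)
    have s0: "s \<noteq> 0" using s2 \<gamma>0 by auto
    have sw: "s * w = of_real \<gamma> / x - x" using s0 by (simp add: w_def)
    have \<delta>n: "1 + \<delta> \<noteq> 0" using x2 x0 by auto
    have "w\<^sup>2 = (of_real \<gamma> / x - x)\<^sup>2 / of_real \<gamma>" by (simp add: w_def power_divide s2)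
    also have "(of_real \<gamma> / x - x)\<^sup>2 = (of_real \<gamma> - x\<^sup>2)\<^sup>2 / x\<^sup>2"
      using x0 by (simp add: field_simps power2_eq_square)
    also have "\<dots> / of_real \<gamma> = - (2 + \<delta>)\<^sup>2 / (1 + \<delta>)"
      unfolding x2 using \<gamma>0 \<delta>n by (simp add: divide_simps) (simp add: power2_eq_square algebra_simps)
    also have "\<dots> = - 4 - \<delta>\<^sup>2 / (1 + \<delta>)" using \<delta>n by (simp add: field_simps power2_eq_square)
    finally have "w\<^sup>2 + 4 = - (\<delta>\<^sup>2 / (1 + \<delta>))" by simp
    moreover have "(w - 2 * \<i>) * (w + 2 * \<i>) = w\<^sup>2 + 4"
      by (simp add: algebra_simps power2_eq_square)
    ultimately have w2: "(w - 2 * \<i>) * (w + 2 * \<i>) = - (\<delta>\<^sup>2 / (1 + \<delta>))" by simp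
    have "cmod (\<delta>\<^sup>2 / (1 + \<delta>)) \<le> (57/1000)\<^sup>2 / (943/1000)"
      unfolding norm_divide norm_power using \<delta>2 \<delta>1 by (intro frac_le power_mono) auto
    then have w3: "cmod (w - 2 * \<i>) * cmod (w + 2 * \<i>) \<le> 4/1000"
      unfolding norm_mult[symmetric] w2 by (simp add: power2_eq_square)
    \<comment> \<open>The roots \<open>2 * \<i>\<close> and \<open>- 2 * \<i>\<close> are 4 apart,
      so one of the two factors is at least 2 and the other at most half of 4/1000; \<sigma> is the
      sign of the nearer root.\<close>
    have "\<exists>\<sigma>. \<bar>\<sigma>\<bar> = 1 \<and> cmod (w - of_real \<sigma> * (2 * \<i>)) \<le> 2/1000"
    proof (cases "cmod (w + 2 * \<i>) \<ge> 2")
      case True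
      then have "cmod (w - 2 * \<i>) * 2 \<le> cmod (w - 2 * \<i>) * cmod (w + 2 * \<i>)" by (intro mult_left_mono) auto
      then show ?thesis using w3 by (intro exI[of _ 1]) auto
    next
      case False
      have "4 \<le> cmod (w - 2 * \<i>) + cmod (w + 2 * \<i>)"
        using norm_triangle_ineq4[of "w + 2 * \<i>" "w - 2 * \<i>"] by (simp add: norm_mult)
      then have "2 * cmod (w + 2 * \<i>) \<le> cmod (w - 2 * \<i>) * cmod (w + 2 * \<i>)"
        using False by (intro mult_right_mono) auto
      then show ?thesis using w3 by (intro exI[of _ "-1"]) auto
    qed
    then obtain \<sigma> where \<sigma>: "\<bar>\<sigma>\<bar> = 1" "cmod (w - of_real \<sigma> * (2 * \<i>)) \<le> 2/1000" by blast
    have \<sigma>2: "\<sigma>\<^sup>2 = 1" using \<sigma>(1) by (metis one_power2 power2_abs)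
    \<comment> \<open>\<beta> is real and the other summand purely imaginary. The triangle
      inequality would give \<open>\<bar>\<beta>\<bar> + 2 * sqrt \<gamma>\<close>, which is too
      large for odd frequencies.\<close>
    have "cmod (of_real \<beta> + s * (of_real \<sigma> * (2 * \<i>))) = sqrt (\<beta>\<^sup>2 + 4 * \<gamma>)"
      using \<gamma> \<sigma>2 by (simp add: s_def cmod_def power_mult_distrib)
    moreover have dec: "of_real \<gamma> / x - x + of_real \<beta> - \<rho>
        = s * (w - of_real \<sigma> * (2 * \<i>)) + (of_real \<beta> + s * (of_real \<sigma> * (2 * \<i>))) - \<rho>"
      unfolding right_diff_distrib sw by simp
    moreover have "cmod (s * (w - of_real \<sigma> * (2 * \<i>))) \<le> sqrt \<gamma> * (2/1000)"
      unfolding norm_mult using \<sigma>(2) \<gamma> by (intro mult_mono) (auto simp: s_def)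
    ultimately have bound: "cmod (of_real \<gamma> / x - x + of_real \<beta> - \<rho>) \<le> sqrt (\<beta>\<^sup>2 + 4 * \<gamma>) + 2/1000 * sqrt \<gamma> + r"
      unfolding dec using \<rho>1 norm_triangle_ineq4[of "s * (w - of_real \<sigma> * (2 * \<i>)) + (of_real \<beta> + s * (of_real \<sigma> * (2 * \<i>)))" \<rho>]
        norm_triangle_ineq[of "s * (w - of_real \<sigma> * (2 * \<i>))" "of_real \<beta> + s * (of_real \<sigma> * (2 * \<i>))"]
      by linarith
    \<comment> \<open>Subtracting the two rows eliminates \<mu>.\<close>
    have "of_real (l 1 - l 0) = (\<mu> - of_real (l 0)) - (\<mu> - of_real (l 1))" by simp
    also have "\<dots> = a * (of_real \<gamma> / x - x + of_real \<beta> - \<rho>)" unfolding e0 e1 by (simp add: algebra_simps)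
    finally have "\<bar>l 1 - l 0\<bar> = cmod a * cmod (of_real \<gamma> / x - x + of_real \<beta> - \<rho>)"
      by (metis norm_mult norm_of_real)
    also have "\<dots> \<le> cmod a * (sqrt (\<beta>\<^sup>2 + 4 * \<gamma>) + 2/1000 * sqrt \<gamma> + r)"
      using bound by (intro mult_left_mono) auto
    finally show False using near_gap by simp
  qed
  then have tz: "c j = 0" if "j \<ge> 1" for j using tail_zero[OF _ L _ that] by simp
  then have "T = 0" by (simp add: T_def)
  then have "c 0 = 0" using T_eq \<open>c 1 = 0\<close> \<gamma>0 by simp
  then show ?thesis using tz by (cases "j = 0") auto
qed

text \<open>Otherwise \<open>k\<close> is chosen least such that \<open>Re \<mu>\<close> does not
  exceed the midpoint of \<open>l (Suc k)\<close> and its successor; it exists because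
  \<open>l\<close> grows at least linearly, and minimality places \<open>Re \<mu>\<close> right of
  the preceding midpoint.\<close>

lemma coeffs_zero: "c j = 0"
proof (cases "Re \<mu> \<le> (l 1 + l 2) / 2")
  case False
  define P where "P n \<longleftrightarrow> Re \<mu> \<le> (l n + l (Suc n)) / 2" for n
  have grow: "l 1 + 2 * h * real n \<le> l (Suc n)" for n
  proof (induction n)
    case (Suc n)
    then show ?case using gap[of "Suc n"] by (simp add: algebra_simps)
  qed simp
  obtain n where n: "Re \<mu> - l 1 < real n * (2 * h)"
    using h reals_Archimedean3[of "2 * h"] by auto
  have "P (Suc n)"
    using n grow[of n] gap[of "Suc n"] h by (simp add: P_def algebra_simps)
  then obtain k where "P (Suc k)" and least: "\<And>i. i < k \<Longrightarrow> \<not> P (Suc i)"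
    using exists_least_iff[of "\<lambda>n. P (Suc n)"] by blast
  moreover have "k \<noteq> 0" using \<open>P (Suc k)\<close> False by (cases k) (auto simp: P_def numeral_2_eq_2)
  moreover have "\<not> P k" using least[of "k - 1"] \<open>k \<noteq> 0\<close> by simp
  ultimately show ?thesis using dominant[of "Suc k" j] by (simp add: P_def)
qed (rule near)

end


section \<open>Sine and cosine expansions on \<open>[0, \<pi>]\<close>\<close>

text \<open>Cosine maps \<open>{0..pi}\<close> bijectively onto \<open>{-1..1}\<close>, so by
  Weierstrass a polynomial in \<open>cos x\<close> is uniformly within any \<open>e\<close> of
  \<open>h\<close>. Orthogonality then bounds the integral of the square of \<open>h\<close> by
  \<open>e * M\<close>.\<close>

lemma real_eq_zero_if_orthogonal_cos_powers:
  fixes h :: "real \<Rightarrow> real"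
  assumes h: "continuous_on {0..pi} h"
    and orth: "\<And>m. integral {0..pi} (\<lambda>x. h x * cos x ^ m) = 0"
    and x: "x \<in> {0..pi}"
  shows "h x = 0"
proof -
  define M where "M = integral {0..pi} (\<lambda>x. \<bar>h x\<bar>)"
  have M0: "M \<ge> 0" unfolding M_def by (rule integral_nonneg) (auto intro!: integrable_continuous_real continuous_intros h)
  have small: "integral {0..pi} (\<lambda>x. (h x)\<^sup>2) \<le> e * M" if e: "e > 0" for e
  proof -
    have "continuous_on {-1..1} (\<lambda>t. h (arccos t))"
      by (rule continuous_on_compose2[OF h continuous_on_arccos']) (auto simp: arccos_lbound arccos_ubound)
    then obtain g where g: "real_polynomial_function g" "\<And>t. t \<in> {-1..1} \<Longrightarrow> \<bar>h (arccos t) - g t\<bar> < e"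
      using Stone_Weierstrass_real_polynomial_function[of "{-1..1}" "\<lambda>t. h (arccos t)" e] e by auto
    obtain p n where p: "g = (\<lambda>t. \<Sum>i\<le>n. p i * t ^ i)"
      using g(1) unfolding real_polynomial_function_iff_sum by blast
    have cg: "continuous_on {0..pi} (\<lambda>x. g (cos x))" unfolding p by (intro continuous_intros)
    have "integral {0..pi} (\<lambda>x. h x * g (cos x)) = integral {0..pi} (\<lambda>x. \<Sum>i\<le>n. p i * (h x * cos x ^ i))"
      unfolding p by (simp add: sum_distrib_left mult_ac)
    also have "\<dots> = (\<Sum>i\<le>n. integral {0..pi} (\<lambda>x. p i * (h x * cos x ^ i)))"
      by (intro integral_sum) (auto intro!: integrable_continuous_real continuous_intros h)
    also have "\<dots> = 0" by (simp add: orth)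
    finally have z: "integral {0..pi} (\<lambda>x. h x * g (cos x)) = 0" .
    have "integral {0..pi} (\<lambda>x. (h x)\<^sup>2) = integral {0..pi} (\<lambda>x. (h x)\<^sup>2) - integral {0..pi} (\<lambda>x. h x * g (cos x))"
      using z by simp
    also have "\<dots> = integral {0..pi} (\<lambda>x. (h x)\<^sup>2 - h x * g (cos x))"
      by (rule integral_diff[symmetric]) (auto intro!: integrable_continuous_real continuous_intros h cg)
    also have "\<dots> \<le> integral {0..pi} (\<lambda>x. e * \<bar>h x\<bar>)"
    proof (rule integral_le)
      fix x assume x: "x \<in> {0..pi}"
      have "\<bar>h x - g (cos x)\<bar> < e" using g(2)[of "cos x"] x by (simp add: arccos_cos)
      then have "\<bar>h x\<bar> * \<bar>h x - g (cos x)\<bar> \<le> \<bar>h x\<bar> * e" by (intro mult_left_mono) auto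
      moreover have "(h x)\<^sup>2 - h x * g (cos x) = h x * (h x - g (cos x))" by (simp add: algebra_simps power2_eq_square)
      ultimately show "(h x)\<^sup>2 - h x * g (cos x) \<le> e * \<bar>h x\<bar>"
        by (metis abs_ge_self abs_mult mult.commute order_trans)
    qed (auto intro!: integrable_continuous_real continuous_intros h cg)
    also have "\<dots> = e * M" by (simp add: M_def)
    finally show ?thesis .
  qed
  have "integral {0..pi} (\<lambda>x. (h x)\<^sup>2) \<le> 0"
  proof (rule field_le_epsilon)
    fix e :: real assume e: "e > 0"
    \<comment> \<open>Division by \<open>M + 1\<close>, since \<open>M\<close> may be 0.\<close>
    have "integral {0..pi} (\<lambda>x. (h x)\<^sup>2) \<le> e / (M + 1) * M" using e M0 by (intro small) simp
    also have "\<dots> \<le> e" using e M0 by (simp add: field_simps)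
    finally show "integral {0..pi} (\<lambda>x. (h x)\<^sup>2) \<le> 0 + e" by simp
  qed
  moreover have "integral {0..pi} (\<lambda>x. (h x)\<^sup>2) \<ge> 0"
    by (rule integral_nonneg) (auto intro!: integrable_continuous_real continuous_intros h)
  ultimately have "integral {0..pi} (\<lambda>x. (h x)\<^sup>2) = 0" by simp
  then have "\<forall>x\<in>{0..pi}. (h x)\<^sup>2 = 0"
    by (subst (asm) integral_eq_0_iff) (auto intro!: continuous_intros h)
  then show ?thesis using x by simp
qed

lemma eq_zero_if_orthogonal_cos_powers:
  fixes h :: "real \<Rightarrow> complex"
  assumes h: "continuous_on {0..pi} h"
    and orth: "\<And>m. integral {0..pi} (\<lambda>x. h x * of_real (cos x ^ m)) = 0"
    and x: "x \<in> {0..pi}"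
  shows "h x = 0"
proof -
  have int: "(\<lambda>x. h x * of_real (cos x ^ m)) integrable_on {0..pi}" for m
    by (intro integrable_continuous_real continuous_intros h)
  have re: "integral {0..pi} (\<lambda>x. Re (h x) * cos x ^ m) = Re (integral {0..pi} (\<lambda>x. h x * of_real (cos x ^ m)))" for m
    using integral_linear[OF int bounded_linear_Re, of m] by (simp add: o_def del: of_real_power)
  have Re: "Re (h x) = 0"
    by (rule real_eq_zero_if_orthogonal_cos_powers[of "\<lambda>x. Re (h x)", OF _ _ x])
      (use orth re in \<open>auto intro!: continuous_intros h\<close>)
  have im: "integral {0..pi} (\<lambda>x. Im (h x) * cos x ^ m) = Im (integral {0..pi} (\<lambda>x. h x * of_real (cos x ^ m)))" for m
    using integral_linear[OF int bounded_linear_Im, of m] by (simp add: o_def del: of_real_power)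
  have Im: "Im (h x) = 0"
    by (rule real_eq_zero_if_orthogonal_cos_powers[of "\<lambda>x. Im (h x)", OF _ _ x])
      (use orth im in \<open>auto intro!: continuous_intros h\<close>)
  show ?thesis using Re Im by (simp add: complex_eq_iff)
qed

text \<open>Integer indices let a recurrence pass through 0; the behaviour under
  \<open>n \<mapsto> - n\<close> later replaces a special first row. There is no conjugation:
  everything is bilinear.\<close>

definition coef :: "(int \<Rightarrow> real \<Rightarrow> real) \<Rightarrow> (real \<Rightarrow> complex) \<Rightarrow> int \<Rightarrow> complex" where
  "coef \<phi> y n = integral {0..pi} (\<lambda>x. y x * of_real (\<phi> n x))"

definition sin_mode :: "int \<Rightarrow> real \<Rightarrow> real" where "sin_mode n x = sin (of_int n * x)"

definition cos_mode :: "int \<Rightarrow> real \<Rightarrow> real" where "cos_mode n x = cos (of_int n * x)"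

lemma modes_continuous [continuous_intros]:
  fixes f :: "real \<Rightarrow> real"
  assumes "continuous_on S f"
  shows "continuous_on S (\<lambda>x. sin_mode n (f x))" "continuous_on S (\<lambda>x. cos_mode n (f x))"
  by (auto simp: sin_mode_def cos_mode_def intro!: continuous_intros assms)

lemma modes_bounded: "\<bar>sin_mode n x\<bar> \<le> 1" "\<bar>cos_mode n x\<bar> \<le> 1"
  by (simp_all add: sin_mode_def cos_mode_def)

lemma modes_minus [simp]: "sin_mode (- n) x = - sin_mode n x" "cos_mode (- n) x = cos_mode n x"
  by (simp_all add: sin_mode_def cos_mode_def)

lemma modes_shift:
  "2 * cos (of_int k * x) * sin_mode n x = sin_mode (n + k) x + sin_mode (n - k) x"
  "2 * cos (of_int k * x) * cos_mode n x = cos_mode (n + k) x + cos_mode (n - k) x"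
  by (simp_all add: sin_mode_def cos_mode_def sin_add cos_add sin_diff cos_diff algebra_simps)

lemma coef_minus: "coef sin_mode y (- n) = - coef sin_mode y n" "coef cos_mode y (- n) = coef cos_mode y n"
  by (simp_all add: coef_def)

lemma integrable_coef:
  fixes y :: "real \<Rightarrow> complex"
  assumes "continuous_on {0..pi} y" "continuous_on {0..pi} g"
  shows "(\<lambda>x. y x * of_real (g x)) integrable_on {0..pi}"
  by (intro integrable_continuous_real continuous_intros assms)

text \<open>Multiplication by \<open>cos x\<close> moves a mode to its two neighbours, so each power
  of cosine can be traded for other modes; hence the induction with \<open>n\<close>
  arbitrary.\<close>

lemma coef_cos_power_zero:
  fixes y :: "real \<Rightarrow> complex"
  assumes y: "continuous_on {0..pi} y" and \<phi>: "\<And>n. continuous_on {0..pi} (\<phi> n)"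
    and shift: "\<And>n x. 2 * cos x * \<phi> n x = \<phi> (n + 1) x + \<phi> (n - 1) x"
    and zero: "\<And>n::int. coef \<phi> y n = 0"
  shows "integral {0..pi} (\<lambda>x. y x * of_real (\<phi> n x) * of_real (cos x ^ m)) = 0"
proof (induction m arbitrary: n)
  case 0
  then show ?case using zero[of n] by (simp add: coef_def)
next
  case (Suc m)
  have "y x * of_real (\<phi> n x) * of_real (cos x ^ Suc m)
      = 1/2 * (y x * of_real (\<phi> (n + 1) x) * of_real (cos x ^ m) + y x * of_real (\<phi> (n - 1) x) * of_real (cos x ^ m))" for x
  proof -
    have "y x * of_real (\<phi> n x) * of_real (cos x ^ Suc m)
      = 1/2 * (y x * of_real (2 * cos x * \<phi> n x) * of_real (cos x ^ m))" by simp
    also have "\<dots> = 1/2 * (y x * of_real (\<phi> (n + 1) x) * of_real (cos x ^ m) + y x * of_real (\<phi> (n - 1) x) * of_real (cos x ^ m))"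
      unfolding shift by (simp add: algebra_simps)
    finally show ?thesis .
  qed
  then have "integral {0..pi} (\<lambda>x. y x * of_real (\<phi> n x) * of_real (cos x ^ Suc m))
      = integral {0..pi} (\<lambda>x. 1/2 * (y x * of_real (\<phi> (n + 1) x) * of_real (cos x ^ m) + y x * of_real (\<phi> (n - 1) x) * of_real (cos x ^ m)))"
    by presburger
  also have "\<dots> = 1/2 * (integral {0..pi} (\<lambda>x. y x * of_real (\<phi> (n + 1) x) * of_real (cos x ^ m))
      + integral {0..pi} (\<lambda>x. y x * of_real (\<phi> (n - 1) x) * of_real (cos x ^ m)))"
    unfolding integral_mult_right
    by (subst integral_add) (auto intro!: integrable_continuous_real continuous_intros y \<phi>)
  also have "\<dots> = 0" by (simp only: Suc.IH) simp
  finally show ?case .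
qed

text \<open>Taking the mode \<open>n = 1\<close> shows that \<open>y x * sin x\<close> vanishes,
  which says nothing at the two endpoints; hence the open interval.\<close>

lemma sin_modes_complete:
  assumes y: "continuous_on {0..pi} y" and zero: "\<And>n. coef sin_mode y (int n) = 0" and x: "x \<in> {0<..<pi}"
  shows "y x = 0"
proof -
  have z: "coef sin_mode y n = 0" for n
  proof (cases "n \<ge> 0")
    case True
    then show ?thesis using zero[of "nat n"] by simp
  next
    case False
    then show ?thesis using zero[of "nat (- n)"] coef_minus(1)[of y n] by simp
  qed
  have "integral {0..pi} (\<lambda>x. y x * of_real (sin_mode 1 x) * of_real (cos x ^ m)) = 0" for m
    using modes_shift(1)[of 1] by (intro coef_cos_power_zero y z) (auto intro!: continuous_intros)
  then have "y x * of_real (sin_mode 1 x) = 0"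
    by (rule eq_zero_if_orthogonal_cos_powers[rotated]) (use x in \<open>auto intro!: continuous_intros y\<close>)
  moreover have "sin_mode 1 x \<noteq> 0" using x sin_gt_zero[of x] by (simp add: sin_mode_def)
  ultimately show ?thesis by simp
qed

lemma cos_modes_complete:
  assumes y: "continuous_on {0..pi} y" and zero: "\<And>n. coef cos_mode y (int n) = 0" and x: "x \<in> {0..pi}"
  shows "y x = 0"
proof -
  have z: "coef cos_mode y n = 0" for n
  proof (cases "n \<ge> 0")
    case True
    then show ?thesis using zero[of "nat n"] by simp
  next
    case False
    then show ?thesis using zero[of "nat (- n)"] coef_minus(2)[of y n] by simp
  qed
  have o: "integral {0..pi} (\<lambda>x. y x * of_real (cos_mode 0 x) * of_real (cos x ^ m)) = 0" for m
    using modes_shift(2)[of 1] by (intro coef_cos_power_zero y z) (auto intro!: continuous_intros)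
  show ?thesis
    by (rule eq_zero_if_orthogonal_cos_powers[OF y]) (use x o in \<open>auto simp: cos_mode_def\<close>)
qed

section \<open>Orthogonality of the modes and a bilinear Parseval identity\<close>

lemma integral_cos_multiple:
  "integral {0..pi} (\<lambda>x. cos (of_int k * x)) = (if k = 0 then pi else 0)"
proof (cases "k = 0")
  case False
  have "((\<lambda>x. cos (of_int k * x)) has_integral (sin (of_int k * pi) / of_int k - sin (of_int k * 0) / of_int k)) {0..pi}"
    using False by (intro fundamental_theorem_of_calculus)
      (auto intro!: derivative_eq_intros simp flip: has_real_derivative_iff_has_vector_derivative)
  moreover have "sin (of_int k * pi) = 0" by (simp add: sin_times_pi_eq_0)
  ultimately show ?thesis using False by (simp add: integral_unique)
qed simp

text \<open>The reciprocals of the integrals of the squared modes; the constant cosine has twice the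
  integral of the others.\<close>

definition mode_weight :: "nat \<Rightarrow> real" where "mode_weight n = (if n = 0 then 1 / pi else 2 / pi)"

lemma modes_inner:
  fixes m n :: nat
  shows "integral {0..pi} (\<lambda>x. sin_mode m x * sin_mode n x) = (if m = n \<and> n \<noteq> 0 then 1 / mode_weight n else 0)"
    and "integral {0..pi} (\<lambda>x. cos_mode m x * cos_mode n x) = (if m = n then 1 / mode_weight n else 0)"
proof -
  have i: "(\<lambda>x. cos (of_int k * x)) integrable_on {0..pi}" for k
    by (intro integrable_continuous_real continuous_intros)
  have e: "(\<lambda>x. sin_mode m x * sin_mode n x) = (\<lambda>x. (cos (of_int (int m - int n) * x) - cos (of_int (int m + int n) * x)) / 2)"
    "(\<lambda>x. cos_mode m x * cos_mode n x) = (\<lambda>x. (cos (of_int (int m - int n) * x) + cos (of_int (int m + int n) * x)) / 2)"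
    by (simp_all add: sin_mode_def cos_mode_def sin_times_sin cos_times_cos algebra_simps)
  show "integral {0..pi} (\<lambda>x. sin_mode m x * sin_mode n x) = (if m = n \<and> n \<noteq> 0 then 1 / mode_weight n else 0)"
    unfolding e integral_divide integral_diff[OF i i] integral_cos_multiple by (auto simp: mode_weight_def)
  show "integral {0..pi} (\<lambda>x. cos_mode m x * cos_mode n x) = (if m = n then 1 / mode_weight n else 0)"
    unfolding e integral_divide integral_add[OF i i] integral_cos_multiple by (auto simp: mode_weight_def)
qed

text \<open>Absolute summability makes the Fourier series converge uniformly to a continuous
  \<open>G\<close> with the coefficients of \<open>y\<close>. By completeness \<open>G = y\<close>
  off the endpoints, and the series is integrated termwise against \<open>y\<close>. The alternative
  in \<open>normal\<close> admits \<open>sin_mode 0\<close>, which is zero.\<close>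

lemma parseval_bilinear:
  fixes y :: "real \<Rightarrow> complex" and \<phi> :: "int \<Rightarrow> real \<Rightarrow> real"
  assumes y: "continuous_on {0..pi} y" and \<phi>: "\<And>n. continuous_on {0..pi} (\<phi> n)"
    and \<phi>1: "\<And>n x. \<bar>\<phi> n x\<bar> \<le> 1"
    and summ: "summable (\<lambda>n. cmod (coef \<phi> y (int n)))"
    and orth: "\<And>m n. m \<noteq> n \<Longrightarrow> integral {0..pi} (\<lambda>x. \<phi> (int m) x * \<phi> (int n) x) = 0"
    and normal: "\<And>n. mode_weight n * integral {0..pi} (\<lambda>x. \<phi> (int n) x * \<phi> (int n) x) = 1 \<or> coef \<phi> y (int n) = 0"
    and complete: "\<And>g x. continuous_on {0..pi} g \<Longrightarrow> (\<And>n. coef \<phi> g (int n) = 0) \<Longrightarrow> x \<in> {0<..<pi} \<Longrightarrow> g x = 0"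
  shows "(\<lambda>n. of_real (mode_weight n) * (coef \<phi> y (int n))\<^sup>2) sums integral {0..pi} (\<lambda>x. (y x)\<^sup>2)"
proof -
  define b where "b n = coef \<phi> y (int n)" for n :: nat
  define t where "t n x = of_real (mode_weight n) * b n * of_real (\<phi> (int n) x)" for n :: nat and x
  define G where "G x = (\<Sum>n. t n x)" for x
  have mw: "0 \<le> mode_weight n" "mode_weight n \<le> 2 / pi" for n by (auto simp: mode_weight_def divide_right_mono)
  have tb: "cmod (t n x) \<le> 2 / pi * cmod (b n)" for n x
  proof -
    have "cmod (t n x) = mode_weight n * cmod (b n) * \<bar>\<phi> (int n) x\<bar>" using mw[of n] by (simp add: t_def norm_mult)
    also have "\<dots> \<le> 2 / pi * cmod (b n) * 1" using mw[of n] \<phi>1 by (intro mult_mono) auto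
    finally show ?thesis by simp
  qed
  have sb: "summable (\<lambda>n. 2 / pi * cmod (b n) * K)" for K
    using summ unfolding b_def by (intro summable_mult2 summable_mult)
  have tc: "continuous_on {0..pi} (t n)" for n unfolding t_def by (intro continuous_intros \<phi>)
  have "uniform_limit {0..pi} (\<lambda>N x. \<Sum>n<N. t n x) G sequentially"
    unfolding G_def by (rule Weierstrass_m_test[OF _ sb[of 1]]) (use tb in simp)
  then have Gc: "continuous_on {0..pi} G"
    by (rule uniform_limit_theorem[rotated]) (auto intro!: always_eventually continuous_intros tc)
  \<comment> \<open>Applied twice: with \<open>f\<close> a mode it yields the coefficients of
    \<open>G\<close>, with \<open>f = y\<close> the conclusion.\<close>
  have swap: "(\<lambda>n. of_real (mode_weight n) * b n * integral {0..pi} (\<lambda>x. of_real (\<phi> (int n) x) * f x)) sums integral {0..pi} (\<lambda>x. G x * f x)"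
    if f: "continuous_on {0..pi} f" for f
  proof -
    obtain K where K: "\<And>x. x \<in> {0..pi} \<Longrightarrow> cmod (f x) \<le> K"
      using compact_imp_bounded[OF compact_continuous_image[OF f]] unfolding bounded_iff by blast
    have st: "summable (\<lambda>n. t n x)" for x
      by (rule summable_norm_cancel, rule summable_comparison_test'[OF sb[of 1]]) (use tb in auto)
    have "uniform_limit {0..pi} (\<lambda>N x. \<Sum>n<N. t n x * f x) (\<lambda>x. \<Sum>n. t n x * f x) sequentially"
    proof (rule Weierstrass_m_test[OF _ sb[of K]])
      fix n x assume "x \<in> {0..pi}"
      then show "cmod (t n x * f x) \<le> 2 / pi * cmod (b n) * K"
        unfolding norm_mult by (intro mult_mono tb K) auto
    qed
    also have "(\<lambda>x. \<Sum>n. t n x * f x) = (\<lambda>x. G x * f x)" unfolding G_def using suminf_mult2[OF st] by simp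
    finally have u: "uniform_limit {0..pi} (\<lambda>N x. \<Sum>n<N. t n x * f x) (\<lambda>x. G x * f x) sequentially" .
    obtain I J where IJ: "\<And>N. ((\<lambda>x. \<Sum>n<N. t n x * f x) has_integral I N) {0..pi}"
      "((\<lambda>x. G x * f x) has_integral J) {0..pi}" "I \<longlonglongrightarrow> J"
      by (rule uniform_limit_integral[OF u]) (auto intro!: continuous_intros tc f)
    have "I N = (\<Sum>n<N. of_real (mode_weight n) * b n * integral {0..pi} (\<lambda>x. of_real (\<phi> (int n) x) * f x))" for N
    proof -
      have "I N = integral {0..pi} (\<lambda>x. \<Sum>n<N. t n x * f x)" by (rule integral_unique[OF IJ(1), symmetric])
      also have "\<dots> = (\<Sum>n<N. integral {0..pi} (\<lambda>x. t n x * f x))"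
        by (intro integral_sum) (auto intro!: integrable_continuous_real continuous_intros tc f)
      also have "\<dots> = (\<Sum>n<N. of_real (mode_weight n) * b n * integral {0..pi} (\<lambda>x. of_real (\<phi> (int n) x) * f x))"
        unfolding t_def by (simp only: mult.assoc integral_mult_right)
      finally show ?thesis .
    qed
    then show ?thesis using IJ(3) unfolding sums_def integral_unique[OF IJ(2)] by presburger
  qed
  have G_coef: "integral {0..pi} (\<lambda>x. G x * of_real (\<phi> (int m) x)) = b m" for m
  proof -
    have o: "integral {0..pi} (\<lambda>x. complex_of_real (\<phi> (int n) x) * of_real (\<phi> (int m) x)) = of_real (integral {0..pi} (\<lambda>x. \<phi> (int n) x * \<phi> (int m) x))" for n
      using integral_linear[OF _ bounded_linear_of_real, of "\<lambda>x. \<phi> (int n) x * \<phi> (int m) x" "{0..pi}"]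
      by (simp add: o_def integrable_continuous_real continuous_intros \<phi>)
    have "(\<lambda>n. of_real (mode_weight n) * b n * integral {0..pi} (\<lambda>x. of_real (\<phi> (int n) x) * of_real (\<phi> (int m) x))) sums b m"
    proof -
      have "of_real (mode_weight n) * b n * integral {0..pi} (\<lambda>x. of_real (\<phi> (int n) x) * of_real (\<phi> (int m) x)) = (if n = m then b m else 0)" for n
        using orth[of n m] normal[of m] unfolding o
        by (auto simp: b_def mult_ac simp flip: of_real_mult)
      then show ?thesis using sums_single[of m "\<lambda>_. b m"] by simp
    qed
    moreover note swap[of "\<lambda>x. of_real (\<phi> (int m) x)"]
    ultimately show ?thesis by (auto intro!: continuous_intros \<phi> dest: sums_unique2)
  qed
  have "coef \<phi> (\<lambda>x. y x - G x) (int n) = 0" for n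
  proof -
    have "coef \<phi> (\<lambda>x. y x - G x) (int n) = integral {0..pi} (\<lambda>x. y x * of_real (\<phi> (int n) x) - G x * of_real (\<phi> (int n) x))"
      by (simp add: coef_def algebra_simps)
    also have "\<dots> = b n - b n"
      by (subst integral_diff) (auto intro!: integrable_coef y \<phi> Gc simp: G_coef, simp add: b_def coef_def)
    finally show ?thesis by simp
  qed
  then have yG: "y x = G x" if "x \<in> {0<..<pi}" for x
    using complete[of "\<lambda>x. y x - G x", OF _ _ that] by (auto intro!: continuous_intros y Gc)
  have "integral {0..pi} (\<lambda>x. (y x)\<^sup>2) = integral {0..pi} (\<lambda>x. G x * y x)"
    by (rule integral_spike[of "{0, pi}"]) (use yG in \<open>auto simp: power2_eq_square\<close>)
  moreover have "integral {0..pi} (\<lambda>x. of_real (\<phi> (int n) x) * y x) = b n" for n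
    by (simp add: b_def coef_def mult.commute)
  ultimately show ?thesis using swap[OF y] by (simp add: b_def power2_eq_square mult.assoc)
qed

lemma parseval_sin:
  assumes "continuous_on {0..pi} y" "summable (\<lambda>n. cmod (coef sin_mode y (int n)))"
  shows "(\<lambda>n. of_real (mode_weight n) * (coef sin_mode y (int n))\<^sup>2) sums integral {0..pi} (\<lambda>x. (y x)\<^sup>2)"
proof (rule parseval_bilinear[OF assms(1) _ _ assms(2)])
  show "mode_weight n * integral {0..pi} (\<lambda>x. sin_mode (int n) x * sin_mode (int n) x) = 1 \<or> coef sin_mode y (int n) = 0" for n
    by (cases "n = 0") (simp add: coef_def sin_mode_def, simp add: modes_inner mode_weight_def)
  show "g x = 0" if "continuous_on {0..pi} g" "\<And>n. coef sin_mode g (int n) = 0" "x \<in> {0<..<pi}" for g x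
    using sin_modes_complete[OF that(1,2)] that(3) by simp
qed (auto intro!: continuous_intros simp: modes_bounded modes_inner)

lemma parseval_cos:
  assumes "continuous_on {0..pi} y" "summable (\<lambda>n. cmod (coef cos_mode y (int n)))"
  shows "(\<lambda>n. of_real (mode_weight n) * (coef cos_mode y (int n))\<^sup>2) sums integral {0..pi} (\<lambda>x. (y x)\<^sup>2)"
proof (rule parseval_bilinear[OF assms(1) _ _ assms(2)])
  show "mode_weight n * integral {0..pi} (\<lambda>x. cos_mode (int n) x * cos_mode (int n) x) = 1 \<or> coef cos_mode y (int n) = 0" for n
    by (auto simp: modes_inner mode_weight_def)
  show "g x = 0" if "continuous_on {0..pi} g" "\<And>n. coef cos_mode g (int n) = 0" "x \<in> {0<..<pi}" for g x
    using cos_modes_complete[OF that(1,2)] that(3) by simp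
qed (auto intro!: continuous_intros simp: modes_bounded modes_inner)


section \<open>Solutions of the Mathieu equation\<close>

text \<open>The classical notion, with the first derivative as an explicit argument, so that
  combinations and reflections carry a known derivative.\<close>

definition twice_deriv :: "(real \<Rightarrow> complex) \<Rightarrow> (real \<Rightarrow> complex) \<Rightarrow> (real \<Rightarrow> complex) \<Rightarrow> bool" where
  "twice_deriv y y' v \<longleftrightarrow> (\<forall>x\<in>{0..pi}. (y has_vector_derivative y' x) (at x within {0..pi}) \<and>
     (y' has_vector_derivative v x) (at x within {0..pi}))"

lemma twice_deriv_continuous:
  assumes "twice_deriv y y' v"
  shows "continuous_on {0..pi} y" "continuous_on {0..pi} y'"
  using assms unfolding twice_deriv_def continuous_on_eq_continuous_within
  by (auto intro: has_vector_derivative_continuous)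

lemma twice_deriv_lincomb:
  assumes "twice_deriv y y' v" "twice_deriv z z' w"
  shows "twice_deriv (\<lambda>x. \<kappa> * y x + \<nu> * z x) (\<lambda>x. \<kappa> * y' x + \<nu> * z' x) (\<lambda>x. \<kappa> * v x + \<nu> * w x)"
  using assms unfolding twice_deriv_def
  by (auto intro!: has_vector_derivative_add has_vector_derivative_mult_right)

lemma twice_deriv_reflect:
  assumes "twice_deriv y y' v"
  shows "twice_deriv (\<lambda>x. y (pi - x)) (\<lambda>x. - y' (pi - x)) (\<lambda>x. v (pi - x))"
proof -
  have im: "(\<lambda>x. pi - x) ` {0..pi} = {0..pi}" by (auto simp: image_iff intro!: bexI[of _ "pi - _"])
  have chain: "((\<lambda>x. f (pi - x)) has_vector_derivative - f' (pi - x)) (at x within {0..pi})"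
    if "\<And>x. x \<in> {0..pi} \<Longrightarrow> (f has_vector_derivative f' x) (at x within {0..pi})" "x \<in> {0..pi}"
    for f f' :: "real \<Rightarrow> complex" and x
  proof -
    have "((\<lambda>x. pi - x) has_vector_derivative -1) (at x within {0..pi})"
      by (auto intro!: derivative_eq_intros)
    from vector_diff_chain_within[OF this, of f "f' (pi - x)"] that
    show ?thesis by (simp add: im o_def)
  qed
  have d: "(y has_vector_derivative y' x) (at x within {0..pi})" "(y' has_vector_derivative v x) (at x within {0..pi})"
    if "x \<in> {0..pi}" for x
    using assms that by (auto simp: twice_deriv_def)
  show ?thesis
    unfolding twice_deriv_def
    using chain[of y y', OF d(1)] has_vector_derivative_minus[OF chain[of y' v, OF d(2)]] by simp
qed

lemma twice_deriv_cong:
  assumes "twice_deriv y y' v" "\<And>x. x \<in> {0..pi} \<Longrightarrow> v x = w x"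
  shows "twice_deriv y y' w"
  using assms by (auto simp: twice_deriv_def)

text \<open>The Wronskian \<open>y' x * z x - y x * z' x\<close> is an antiderivative. With
  \<open>z\<close> a mode this gives the recurrence, with \<open>z\<close> an eigenfunction the
  symmetry of the operators.\<close>

lemma green:
  assumes "twice_deriv y y' v" "twice_deriv z z' w"
  shows "((\<lambda>x. v x * z x - y x * w x) has_integral
    (y' pi * z pi - y pi * z' pi) - (y' 0 * z 0 - y 0 * z' 0)) {0..pi}"
proof (rule fundamental_theorem_of_calculus)
  fix x assume x: "x \<in> {0..pi}"
  have "((\<lambda>x. y' x * z x - y x * z' x) has_vector_derivative
      (y' x * z' x + v x * z x) - (y x * w x + y' x * z' x)) (at x within {0..pi})"
    using assms x unfolding twice_deriv_def
    by (intro has_vector_derivative_diff has_vector_derivative_mult) auto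
  then show "((\<lambda>x. y' x * z x - y x * z' x) has_vector_derivative v x * z x - y x * w x) (at x within {0..pi})"
    by simp
qed simp

definition mathieu_solution :: "complex \<Rightarrow> complex \<Rightarrow> (real \<Rightarrow> complex) \<Rightarrow> (real \<Rightarrow> complex) \<Rightarrow> bool" where
  "mathieu_solution a \<mu> y y' \<longleftrightarrow> twice_deriv y y' (\<lambda>x. (mathieu_potential a x - \<mu>) * y x)"

lemma mathieu_solution_continuous:
  assumes "mathieu_solution a \<mu> y y'"
  shows "continuous_on {0..pi} y" "continuous_on {0..pi} y'"
  using assms twice_deriv_continuous unfolding mathieu_solution_def by blast+

lemma mathieu_solution_lincomb:
  assumes "mathieu_solution a \<mu> y y'" "mathieu_solution a \<mu> z z'"
  shows "mathieu_solution a \<mu> (\<lambda>x. \<kappa> * y x + \<nu> * z x) (\<lambda>x. \<kappa> * y' x + \<nu> * z' x)"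
  unfolding mathieu_solution_def
  by (rule twice_deriv_cong[OF twice_deriv_lincomb[OF assms[unfolded mathieu_solution_def]]])
    (simp add: algebra_simps)

lemma mathieu_solution_reflect:
  assumes "mathieu_solution a \<mu> y y'"
  shows "mathieu_solution a \<mu> (\<lambda>x. y (pi - x)) (\<lambda>x. - y' (pi - x))"
proof -
  have "mathieu_potential a (pi - x) = mathieu_potential a x" for x
    by (simp add: mathieu_potential_def right_diff_distrib cos_diff)
  then show ?thesis
    using twice_deriv_reflect[OF assms[unfolded mathieu_solution_def]] by (simp add: mathieu_solution_def)
qed

text \<open>Gronwall's argument for \<open>\<bar>y\<bar>\<^sup>2 + \<bar>y'\<bar>\<^sup>2\<close>.\<close>

lemma mathieu_solution_unique:
  assumes sol: "mathieu_solution a \<mu> y y'" and "y 0 = 0" "y' 0 = 0" and x: "x \<in> {0..pi}"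
  shows "y x = 0"
proof -
  \<comment> \<open>\<open>K - 1\<close> bounds the size of the potential minus \<mu>; the remaining
    1 pays for the product of \<open>y\<close> and \<open>y'\<close>, so that \<open>E\<close> does
    not increase.\<close>
  define K where "K = 2 * cmod a + cmod \<mu> + 1"
  define e where "e t = y t \<bullet> y t + y' t \<bullet> y' t" for t
  define E where "E t = e t * exp (- K * t)" for t
  have cont: "continuous_on {0..pi} E"
    unfolding E_def e_def by (intro continuous_intros mathieu_solution_continuous[OF sol])
  have dE: "\<exists>D. (E has_real_derivative D) (at t) \<and> D \<le> 0" if t: "0 < t" "t < x" for t
  proof -
    define v where "v = (mathieu_potential a t - \<mu>) * y t"
    have at: "at t within {0..pi} = at t" using t x by (intro at_within_Icc_at) auto
    have dy: "(y has_vector_derivative y' t) (at t)" "(y' has_vector_derivative v) (at t)"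
      using sol t x unfolding mathieu_solution_def twice_deriv_def v_def by (auto simp flip: at)
    have "(e has_vector_derivative 2 * (y t \<bullet> y' t) + 2 * (y' t \<bullet> v)) (at t)"
      using dy unfolding e_def by (auto intro!: derivative_eq_intros simp: inner_commute has_vector_derivative_def algebra_simps)
    then have "(e has_real_derivative 2 * (y t \<bullet> y' t) + 2 * (y' t \<bullet> v)) (at t)"
      by (simp add: has_real_derivative_iff_has_vector_derivative)
    then have "(E has_real_derivative (2 * (y t \<bullet> y' t) + 2 * (y' t \<bullet> v) - K * e t) * exp (- K * t)) (at t)"
      unfolding E_def by (auto intro!: derivative_eq_intros simp: algebra_simps)
    moreover have "2 * (y t \<bullet> y' t) + 2 * (y' t \<bullet> v) \<le> K * e t"
    proof -
      have "cmod (mathieu_potential a t) \<le> 2 * cmod a"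
        using abs_cos_le_one[of "2 * t"] mult_left_mono[of "\<bar>cos (2 * t)\<bar>" 1 "2 * cmod a"]
        by (simp add: mathieu_potential_def norm_mult)
      then have "cmod (mathieu_potential a t - \<mu>) \<le> K - 1"
        unfolding K_def using norm_triangle_ineq4[of "mathieu_potential a t" \<mu>] by simp
      then have v: "cmod v \<le> (K - 1) * cmod (y t)" unfolding v_def norm_mult by (intro mult_right_mono) auto
      have "y t \<bullet> y' t \<le> cmod (y t) * cmod (y' t)" by (rule norm_cauchy_schwarz)
      moreover have "y' t \<bullet> v \<le> (K - 1) * (cmod (y t) * cmod (y' t))"
        using norm_cauchy_schwarz[of "y' t" v] mult_left_mono[OF v norm_ge_zero[of "y' t"]] by (simp add: mult_ac)
      ultimately have "2 * (y t \<bullet> y' t) + 2 * (y' t \<bullet> v) \<le> K * (2 * cmod (y t) * cmod (y' t))"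
        by (simp add: algebra_simps)
      also have "\<dots> \<le> K * ((cmod (y t))\<^sup>2 + (cmod (y' t))\<^sup>2)"
        using sum_squares_bound[of "cmod (y t)" "cmod (y' t)"] by (intro mult_left_mono) (auto simp: K_def)
      finally show ?thesis by (simp add: e_def power2_norm_eq_inner)
    qed
    ultimately show ?thesis by (intro exI conjI) (auto intro!: mult_nonpos_nonneg)
  qed
  have "E x \<le> E 0"
  proof (cases "x = 0")
    case False
    show ?thesis
      by (rule DERIV_nonpos_imp_decreasing_open[of 0 x E])
        (use False x dE in \<open>auto intro: continuous_on_subset[OF cont]\<close>)
  qed simp
  also have "E 0 = 0" using assms by (simp add: E_def e_def)
  finally have "y x \<bullet> y x + y' x \<bullet> y' x \<le> 0" by (simp add: E_def e_def mult_le_0_iff)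
  moreover have "y x \<bullet> y x \<ge> 0" "y' x \<bullet> y' x \<ge> 0" by simp_all
  ultimately have "y x \<bullet> y x = 0" by linarith
  then show ?thesis by simp
qed

section \<open>The recurrence of the Fourier coefficients and their decay\<close>

lemma modes_deriv:
  "(sin_mode n has_real_derivative of_int n * cos_mode n x) (at x within S)"
  "(cos_mode n has_real_derivative - of_int n * sin_mode n x) (at x within S)"
  unfolding sin_mode_def cos_mode_def by (auto intro!: derivative_eq_intros simp: mult.commute)

lemma modes_twice_deriv:
  "twice_deriv (\<lambda>x. of_real (sin_mode n x)) (\<lambda>x. of_int n * of_real (cos_mode n x)) (\<lambda>x. - (of_int n)\<^sup>2 * of_real (sin_mode n x))"
  "twice_deriv (\<lambda>x. of_real (cos_mode n x)) (\<lambda>x. - of_int n * of_real (sin_mode n x)) (\<lambda>x. - (of_int n)\<^sup>2 * of_real (cos_mode n x))"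
proof -
  have d: "((\<lambda>x. complex_of_real (sin_mode n x)) has_vector_derivative of_int n * of_real (cos_mode n x)) (at x within S)"
    "((\<lambda>x. complex_of_real (cos_mode n x)) has_vector_derivative - of_int n * of_real (sin_mode n x)) (at x within S)" for x S
    using has_vector_derivative_of_real[OF modes_deriv(1)[of n x S]] has_vector_derivative_of_real[OF modes_deriv(2)[of n x S]]
    by simp_all
  show "twice_deriv (\<lambda>x. of_real (sin_mode n x)) (\<lambda>x. of_int n * of_real (cos_mode n x)) (\<lambda>x. - (of_int n)\<^sup>2 * of_real (sin_mode n x))"
    unfolding twice_deriv_def
    using d(1) has_vector_derivative_mult_right[OF d(2), of "of_int n"] by (simp add: power2_eq_square mult.assoc)
  show "twice_deriv (\<lambda>x. of_real (cos_mode n x)) (\<lambda>x. - of_int n * of_real (sin_mode n x)) (\<lambda>x. - (of_int n)\<^sup>2 * of_real (cos_mode n x))"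
    unfolding twice_deriv_def
    using d(2) has_vector_derivative_mult_right[OF d(1), of "- of_int n"] by (simp add: power2_eq_square mult.assoc)
qed

definition mathieu_recurrence :: "complex \<Rightarrow> complex \<Rightarrow> (int \<Rightarrow> complex) \<Rightarrow> bool" where
  "mathieu_recurrence a \<mu> f \<longleftrightarrow> (\<forall>n. ((of_int n)\<^sup>2 - \<mu>) * f n + a * (f (n - 2) + f (n + 2)) = 0)"

text \<open>Green's formula against the mode \<open>n\<close>: \<open>bdry\<close> cancels the
  boundary terms, and the factor \<open>cos (2 * x)\<close> of the potential moves the index by
  2.\<close>

lemma coef_recurrence:
  assumes sol: "mathieu_solution a \<mu> y y'"
    and \<phi>: "\<And>n. twice_deriv (\<lambda>x. of_real (\<phi> n x)) (\<phi>' n) (\<lambda>x. - (of_int n)\<^sup>2 * of_real (\<phi> n x))"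
    and \<phi>c: "\<And>n. continuous_on {0..pi} (\<phi> n)"
    and shift: "\<And>n x. 2 * cos (2 * x) * \<phi> n x = \<phi> (n + 2) x + \<phi> (n - 2) x"
    and bdry: "\<And>n. y' pi * of_real (\<phi> n pi) - y pi * \<phi>' n pi = y' 0 * of_real (\<phi> n 0) - y 0 * \<phi>' n 0"
  shows "mathieu_recurrence a \<mu> (coef \<phi> y)"
  unfolding mathieu_recurrence_def
proof
  fix n
  have y: "continuous_on {0..pi} y" using mathieu_solution_continuous[OF sol] by simp
  have pw: "(mathieu_potential a x - \<mu>) * y x * of_real (\<phi> n x) - y x * (- (of_int n)\<^sup>2 * of_real (\<phi> n x))
    = ((of_int n)\<^sup>2 - \<mu>) * (y x * of_real (\<phi> n x)) + a * (y x * of_real (\<phi> (n - 2) x) + y x * of_real (\<phi> (n + 2) x))" for x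
  proof -
    have "mathieu_potential a x * of_real (\<phi> n x) = a * of_real (2 * cos (2 * x) * \<phi> n x)"
      by (simp add: mathieu_potential_def)
    then have "mathieu_potential a x * of_real (\<phi> n x) = a * (of_real (\<phi> (n - 2) x) + of_real (\<phi> (n + 2) x))"
      unfolding shift by (simp add: add.commute)
    then show ?thesis by (simp add: algebra_simps)
  qed
  have "((\<lambda>x. ((of_int n)\<^sup>2 - \<mu>) * (y x * of_real (\<phi> n x)) + a * (y x * of_real (\<phi> (n - 2) x) + y x * of_real (\<phi> (n + 2) x))) has_integral 0) {0..pi}"
    using green[OF sol[unfolded mathieu_solution_def] \<phi>[of n]] bdry[of n] unfolding pw by simp
  moreover have "((\<lambda>x. ((of_int n)\<^sup>2 - \<mu>) * (y x * of_real (\<phi> n x)) + a * (y x * of_real (\<phi> (n - 2) x) + y x * of_real (\<phi> (n + 2) x)))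
    has_integral (((of_int n)\<^sup>2 - \<mu>) * coef \<phi> y n + a * (coef \<phi> y (n - 2) + coef \<phi> y (n + 2)))) {0..pi}"
    unfolding coef_def
    by (intro has_integral_add has_integral_mult_right integrable_integral integrable_coef y \<phi>c)
  ultimately show "((of_int n)\<^sup>2 - \<mu>) * coef \<phi> y n + a * (coef \<phi> y (n - 2) + coef \<phi> y (n + 2)) = 0"
    using has_integral_unique by blast
qed

lemma sin_int_pi: "sin (of_int n * pi) = 0"
  by (simp add: sin_times_pi_eq_0)

lemma dirichlet_recurrence:
  assumes "mathieu_solution a \<mu> y y'" "y 0 = 0" "y pi = 0"
  shows "mathieu_recurrence a \<mu> (coef sin_mode y)"
  by (rule coef_recurrence[OF assms(1) modes_twice_deriv(1)])
    (use assms modes_shift(1)[of 2] in \<open>auto intro!: continuous_intros simp: sin_mode_def sin_int_pi\<close>)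

lemma neumann_recurrence:
  assumes "mathieu_solution a \<mu> y y'" "y' 0 = 0" "y' pi = 0"
  shows "mathieu_recurrence a \<mu> (coef cos_mode y)"
  by (rule coef_recurrence[OF assms(1) modes_twice_deriv(2)])
    (use assms modes_shift(2)[of 2] in \<open>auto intro!: continuous_intros simp: sin_mode_def sin_int_pi\<close>)

text \<open>For large \<open>n\<close> the diagonal entry has size at least
  \<open>n\<^sup>2 / 2\<close>, so a bounded solution of the recurrence is already of order
  \<open>1 / n\<^sup>2\<close>.\<close>

lemma mathieu_recurrence_summable:
  assumes rec: "mathieu_recurrence a \<mu> f" and M: "\<And>n. cmod (f n) \<le> M"
  shows "summable (\<lambda>n. cmod (f (int n)))"
proof (rule summable_comparison_test_ev)
  obtain N :: nat where N: "2 * cmod \<mu> < real N" using reals_Archimedean2 by blast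
  have "cmod (f (int n)) \<le> 4 * cmod a * M * inverse ((real n)\<^sup>2)" if n: "n \<ge> Suc N" for n
  proof -
    have sq: "2 * cmod \<mu> \<le> (real n)\<^sup>2"
    proof -
      have "2 * cmod \<mu> \<le> real n" using N n by simp
      also have "\<dots> \<le> real n * real n" using n by (intro mult_le_cancel_left1[THEN iffD2]) auto
      finally show ?thesis by (simp add: power2_eq_square)
    qed
    have "(real n)\<^sup>2 / 2 \<le> cmod ((of_int (int n))\<^sup>2 - \<mu>)"
      using norm_triangle_ineq2[of "(of_nat n)\<^sup>2" \<mu>] sq by (simp add: norm_power)
    then have "(real n)\<^sup>2 / 2 * cmod (f (int n)) \<le> cmod (((of_int (int n))\<^sup>2 - \<mu>) * f (int n))"
      unfolding norm_mult by (intro mult_right_mono) auto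
    also have "((of_int (int n))\<^sup>2 - \<mu>) * f (int n) = - (a * (f (int n - 2) + f (int n + 2)))"
      using rec[unfolded mathieu_recurrence_def, rule_format, of "int n"] by (simp add: eq_neg_iff_add_eq_0)
    also have "cmod \<dots> = cmod a * cmod (f (int n - 2) + f (int n + 2))" by (simp add: norm_mult)
    also have "\<dots> \<le> cmod a * (M + M)"
      using norm_triangle_le add_mono[OF M M] by (intro mult_left_mono) (auto simp: norm_triangle_le)
    finally show ?thesis using n by (simp add: field_simps)
  qed
  then show "\<forall>\<^sub>F n in sequentially. norm (cmod (f (int n))) \<le> 4 * cmod a * M * inverse ((real n)\<^sup>2)"
    unfolding eventually_sequentially by (intro exI[of _ "Suc N"]) simp
  show "summable (\<lambda>n. 4 * cmod a * M * inverse ((real n)\<^sup>2))"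
    by (intro summable_mult inverse_power_summable) simp
qed

lemma coef_bounded:
  assumes y: "continuous_on {0..pi} y" and \<phi>: "\<And>n. continuous_on {0..pi} (\<phi> n)" "\<And>n x. \<bar>\<phi> n x\<bar> \<le> 1"
  shows "cmod (coef \<phi> y n) \<le> integral {0..pi} (\<lambda>x. cmod (y x))"
  unfolding coef_def
proof (rule integral_norm_bound_integral)
  show "cmod (y x * of_real (\<phi> n x)) \<le> cmod (y x)" for x
    using mult_left_mono[OF \<phi>(2)[of n x] norm_ge_zero[of "y x"]] by (simp add: norm_mult)
qed (auto intro!: integrable_coef integrable_continuous_real continuous_intros y \<phi>)

lemma dirichlet_summable:
  assumes "mathieu_solution a \<mu> y y'" "y 0 = 0" "y pi = 0"
  shows "summable (\<lambda>n. cmod (coef sin_mode y (int n)))"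
  by (rule mathieu_recurrence_summable[OF dirichlet_recurrence[OF assms]
        coef_bounded[OF mathieu_solution_continuous(1)[OF assms(1)]]])
    (auto intro!: continuous_intros modes_bounded)

lemma neumann_summable:
  assumes "mathieu_solution a \<mu> y y'" "y' 0 = 0" "y' pi = 0"
  shows "summable (\<lambda>n. cmod (coef cos_mode y (int n)))"
  by (rule mathieu_recurrence_summable[OF neumann_recurrence[OF assms]
        coef_bounded[OF mathieu_solution_continuous(1)[OF assms(1)]]])
    (auto intro!: continuous_intros modes_bounded)

lemma dirichlet_coef_zero:
  assumes "mathieu_solution a \<mu> y y'" "y 0 = 0" "y pi = 0" "\<And>n. coef sin_mode y (int n) = 0" "x \<in> {0..pi}"
  shows "y x = 0"
  using sin_modes_complete[OF mathieu_solution_continuous(1)[OF assms(1)] assms(4), of x] assms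
  by (cases "x \<in> {0<..<pi}") (auto simp: not_less le_less)

lemma neumann_coef_zero:
  assumes "mathieu_solution a \<mu> y y'" "\<And>n. coef cos_mode y (int n) = 0" "x \<in> {0..pi}"
  shows "y x = 0"
  using cos_modes_complete[OF mathieu_solution_continuous(1)[OF assms(1)] assms(2,3)] .

section \<open>Parity about the midpoint of the interval\<close>

lemma integral_reflect_0_pi:
  fixes f :: "real \<Rightarrow> complex"
  shows "integral {0..pi} (\<lambda>x. f (pi - x)) = integral {0..pi} f"
proof -
  have "integral {0..pi} (\<lambda>x. f (pi - x)) = integral {-pi..0} (\<lambda>x. f (x + pi))"
    using Henstock_Kurzweil_Integration.integral_reflect_real[where a = "- pi" and b = 0 and f = "\<lambda>x. f (x + pi)"] by (simp add: add.commute)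
  also have "\<dots> = integral {0..pi} f"
    using integral_shift_real_ivl[of 0 pi pi f] by simp
  finally show ?thesis .
qed

lemma modes_reflect:
  "sin_mode n (pi - x) = (if even n then - sin_mode n x else sin_mode n x)"
  "cos_mode n (pi - x) = (if even n then cos_mode n x else - cos_mode n x)"
proof -
  have c: "cos (of_int n * pi) = (if even n then 1 else -1)"
    using cos_int_times_real[of n 1] by (auto simp: mult.commute cos_npi_int)
  show "sin_mode n (pi - x) = (if even n then - sin_mode n x else sin_mode n x)"
    "cos_mode n (pi - x) = (if even n then cos_mode n x else - cos_mode n x)"
    by (simp_all add: sin_mode_def cos_mode_def right_diff_distrib sin_diff cos_diff sin_int_pi c)
qed

lemma coef_reflect_zero:
  assumes anti: "\<And>x. x \<in> {0..pi} \<Longrightarrow> y (pi - x) * of_real (\<phi> n (pi - x)) = - (y x * of_real (\<phi> n x))"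
  shows "coef \<phi> y n = 0"
proof -
  have "coef \<phi> y n = integral {0..pi} (\<lambda>x. y (pi - x) * of_real (\<phi> n (pi - x)))"
    unfolding coef_def
    by (rule integral_reflect_0_pi[of "\<lambda>x. y x * of_real (\<phi> n x)", symmetric])
  also have "\<dots> = integral {0..pi} (\<lambda>x. - (y x * of_real (\<phi> n x)))" by (rule integral_cong) (rule anti)
  also have "\<dots> = - coef \<phi> y n" by (simp add: coef_def)
  finally show ?thesis by simp
qed


section \<open>Dirichlet and Neumann solutions\<close>

lemma cmod_le_8_sqrt6: "x \<le> 8 / sqrt 6 \<Longrightarrow> x \<le> 3266/1000"
proof -
  assume x: "x \<le> 8 / sqrt 6"
  have "244948/100000 \<le> sqrt 6" by (rule real_le_rsqrt) (simp add: power2_eq_square)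
  then have "8 / sqrt 6 \<le> 8 / (244948/100000)" by (intro divide_left_mono) auto
  then show ?thesis using x by simp
qed

lemma sums_odd_part:
  fixes s :: "nat \<Rightarrow> complex"
  assumes "(\<lambda>n. of_real (mode_weight n) * (s n)\<^sup>2) sums 0" and "\<And>n. even n \<Longrightarrow> s n = 0"
  shows "(\<lambda>j. (s (2 * Suc j + 1))\<^sup>2) sums (- (s 1)\<^sup>2)"
proof -
  have off: "s n = 0" if "n \<notin> range (\<lambda>j. 2 * j + 1)" for n
    using that by (intro assms(2)) (metis oddE rangeI)
  have "(\<lambda>j. of_real (mode_weight (2 * j + 1)) * (s (2 * j + 1))\<^sup>2) sums 0"
    by (subst sums_mono_reindex[of "\<lambda>j. 2 * j + 1" "\<lambda>n. of_real (mode_weight n) * (s n)\<^sup>2"])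
      (use assms off in \<open>auto simp: strict_mono_def\<close>)
  then have "(\<lambda>j. of_real (pi / 2) * (of_real (mode_weight (2 * j + 1)) * (s (2 * j + 1))\<^sup>2)) sums (of_real (pi / 2) * 0)"
    by (rule sums_mult)
  then have "(\<lambda>j. (s (2 * j + 1))\<^sup>2) sums 0" by (simp add: mode_weight_def)
  then show ?thesis using sums_Suc_iff[of "\<lambda>j. (s (2 * j + 1))\<^sup>2" "- (s 1)\<^sup>2"] by simp
qed

text \<open>The factor 1/2 comes from the smaller weight of the constant mode; it is the \<gamma> =
  2 of the even cosine series.\<close>

lemma sums_even_part:
  fixes s :: "nat \<Rightarrow> complex"
  assumes "(\<lambda>n. of_real (mode_weight n) * (s n)\<^sup>2) sums 0" and "\<And>n. odd n \<Longrightarrow> s n = 0"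
  shows "(\<lambda>j. (s (2 * Suc j))\<^sup>2) sums (- (s 0)\<^sup>2 / 2)"
proof -
  have "(\<lambda>j. of_real (mode_weight (2 * j)) * (s (2 * j))\<^sup>2) sums 0"
    by (subst sums_mono_reindex[of "\<lambda>j. 2 * j" "\<lambda>n. of_real (mode_weight n) * (s n)\<^sup>2"])
      (use assms in \<open>auto simp: strict_mono_def elim!: evenE\<close>)
  then have "(\<lambda>j. of_real (mode_weight (2 * Suc j)) * (s (2 * Suc j))\<^sup>2) sums (- (of_real (1 / pi) * (s 0)\<^sup>2))"
    by (subst sums_Suc_iff) (simp add: mode_weight_def)
  then have "(\<lambda>j. of_real (pi / 2) * (of_real (mode_weight (2 * Suc j)) * (s (2 * Suc j))\<^sup>2)) sums (of_real (pi / 2) * (- (of_real (1 / pi) * (s 0)\<^sup>2)))"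
    by (rule sums_mult)
  then show ?thesis by (simp add: mode_weight_def)
qed

text \<open>The row of frequency 1 refers to \<open>f (- 1)\<close>, which adds
  \<open>\<beta> * a\<close> to the diagonal: \<beta> is -1 for sines and 1 for cosines. The
  \<open>l j\<close> are 1, 9, 25, ..., and \<open>h = 8\<close> is half of 25 - 9.\<close>

lemma odd_coeffs_zero:
  assumes rec: "mathieu_recurrence a \<mu> f" and a: "0 < cmod a" "cmod a \<le> 8 / sqrt 6"
    and refl: "f (- 1) = of_real \<beta> * f 1" and \<beta>: "\<bar>\<beta>\<bar> = 1"
    and lim: "(\<lambda>n. f (int n)) \<longlonglongrightarrow> 0"
    and par: "(\<lambda>n. of_real (mode_weight n) * (f (int n))\<^sup>2) sums 0"
    and even: "\<And>n. even n \<Longrightarrow> f n = 0"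
  shows "f (int n) = 0"
proof -
  have a2: "cmod a \<le> 3266/1000" using cmod_le_8_sqrt6[OF a(2)] .
  note r = rec[unfolded mathieu_recurrence_def, rule_format]
  have "mathieu_coeffs a \<mu> \<beta> 1 8 (205/1000) (\<lambda>j. (2 * real j + 1)\<^sup>2) (\<lambda>j. f (int (2 * j + 1)))"
  \<comment> \<open>Goals are numbered as in the locale: 12 is \<open>near_dist\<close>, 13 is
    \<open>near_gap\<close>, 14 is \<open>isotropic\<close>.\<close>
  proof (unfold_locales, goal_cases)
    case 2
    then show ?case using r[of 1] refl by (simp add: algebra_simps)
  next
    case (3 j)
    then show ?case using r[of "int (2 * Suc j + 1)"] by (simp add: add.commute)
  next
    case 4
    show ?case using LIMSEQ_subseq_LIMSEQ[OF lim, of "\<lambda>j. 2 * j + 1"] by (simp add: o_def strict_mono_def)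
  next
    case (6 j)
    then show ?case by (simp add: power2_eq_square algebra_simps)
  next
    case 12
    show ?case using a2 \<beta> by (simp add: field_simps)
  next
    case 13
    have "\<beta>\<^sup>2 = 1" using \<beta> by (metis one_power2 power2_abs)
    moreover have "sqrt 5 \<le> 223607/100000" by (rule real_le_lsqrt) (auto simp: power2_eq_square)
    \<comment> \<open>The tightest estimate: about 7.98, against
      \<open>l 1 - l 0 = 8\<close>.\<close>
    ultimately have "cmod a * (sqrt (\<beta>\<^sup>2 + 4 * 1) + 2 / 1000 * sqrt 1 + 205 / 1000)
      \<le> 3266/1000 * (223607/100000 + 2/1000 * 1 + 205/1000)"
      using a2 by (intro mult_mono add_mono) auto
    then show ?case by (simp add: power2_eq_square)
  next
    case 14
    have "(\<lambda>j. (f (int (2 * Suc j + 1)))\<^sup>2) sums (- (f (int 1))\<^sup>2)"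
      by (rule sums_odd_part[OF par]) (use even in simp)
    then show ?case by simp
  qed (use a a2 \<beta> in auto)
  then have "f (int (2 * j + 1)) = 0" for j by (rule mathieu_coeffs.coeffs_zero)
  then show ?thesis using even by (cases "even n") (auto elim!: oddE)
qed

text \<open>In the row of frequency 0 both neighbours equal \<open>f 2\<close>, whence \<gamma> = 2.
  The \<open>l j\<close> are 0, 4, 16, ..., with \<open>h = 6\<close>; in \<open>near_gap\<close>
  about 3.92 stands against 4.\<close>

lemma even_cos_coeffs_zero:
  assumes rec: "mathieu_recurrence a \<mu> f" and a: "0 < cmod a" "cmod a \<le> 4 / 3"
    and refl: "f (- 2) = f 2"
    and lim: "(\<lambda>n. f (int n)) \<longlonglongrightarrow> 0"
    and par: "(\<lambda>n. of_real (mode_weight n) * (f (int n))\<^sup>2) sums 0"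
    and odd: "\<And>n. odd n \<Longrightarrow> f n = 0"
  shows "f (int n) = 0"
proof -
  note r = rec[unfolded mathieu_recurrence_def, rule_format]
  have "mathieu_coeffs a \<mu> 0 2 6 (11/100) (\<lambda>j. (2 * real j)\<^sup>2) (\<lambda>j. f (int (2 * j)))"
  proof (unfold_locales, goal_cases)
    case 2
    then show ?case using r[of 0] refl by (simp add: algebra_simps)
  next
    case (3 j)
    then show ?case using r[of "int (2 * Suc j)"] by (simp add: add.commute)
  next
    case 4
    show ?case using LIMSEQ_subseq_LIMSEQ[OF lim, of "\<lambda>j. 2 * j"] by (simp add: o_def strict_mono_def)
  next
    case (6 j)
    then show ?case by (simp add: power2_eq_square algebra_simps)
  next
    case 12
    define X where "X = cmod a * (\<bar>0\<bar> + 44/100 + 31/100 * sqrt 2)"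
    have "sqrt 2 \<le> 15/10" by (rule real_le_lsqrt) (auto simp: power2_eq_square)
    then have "X \<le> 4/3 * (\<bar>0\<bar> + 44/100 + 31/100 * (15/10))"
      unfolding X_def using a by (intro mult_mono add_mono) auto
    then show ?case unfolding X_def[symmetric] using a by (simp add: field_simps)
  next
    case 13
    have "sqrt 8 \<le> 283/100" by (rule real_le_lsqrt) (auto simp: power2_eq_square)
    moreover have "sqrt 2 \<le> 15/10" by (rule real_le_lsqrt) (auto simp: power2_eq_square)
    ultimately have "cmod a * (sqrt (0\<^sup>2 + 4 * 2) + 2 / 1000 * sqrt 2 + 11 / 100)
      \<le> 4/3 * (283/100 + 2/1000 * (15/10) + 11 / 100)"
      using a by (intro mult_mono add_mono) auto
    then show ?case by (simp add: power2_eq_square)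
  next
    case 14
    have "(\<lambda>j. (f (int (2 * Suc j)))\<^sup>2) sums (- (f (int 0))\<^sup>2 / 2)"
      by (rule sums_even_part[OF par]) (use odd in simp)
    then show ?case by simp
  qed (use a in auto)
  then have "f (int (2 * j)) = 0" for j by (rule mathieu_coeffs.coeffs_zero)
  then show ?thesis using odd by (cases "even n") (auto elim!: evenE)
qed

text \<open>As \<open>f 0 = 0\<close>, the first row, of frequency 2, has no left neighbour: \<beta>
  = 0 and \<gamma> = 1. The \<open>l j\<close> are 4, 16, 36, ..., with \<open>h = 10\<close>, so
  the gap \<open>l 1 - l 0 = 12\<close> leaves ample room.\<close>

lemma even_sin_coeffs_zero:
  assumes rec: "mathieu_recurrence a \<mu> f" and a: "0 < cmod a" "cmod a \<le> 8 / sqrt 6"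
    and f0: "f 0 = 0"
    and lim: "(\<lambda>n. f (int n)) \<longlonglongrightarrow> 0"
    and par: "(\<lambda>n. of_real (mode_weight n) * (f (int n))\<^sup>2) sums 0"
    and odd: "\<And>n. odd n \<Longrightarrow> f n = 0"
  shows "f (int n) = 0"
proof -
  have a2: "cmod a \<le> 3266/1000" using cmod_le_8_sqrt6[OF a(2)] .
  note r = rec[unfolded mathieu_recurrence_def, rule_format]
  have "mathieu_coeffs a \<mu> 0 1 10 (205/1000) (\<lambda>j. (2 * real j + 2)\<^sup>2) (\<lambda>j. f (int (2 * j + 2)))"
  proof (unfold_locales, goal_cases)
    case 2
    then show ?case using r[of 2] f0 by (simp add: algebra_simps)
  next
    case (3 j)
    then show ?case using r[of "int (2 * Suc j + 2)"] by (simp add: add.commute)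
  next
    case 4
    show ?case using LIMSEQ_subseq_LIMSEQ[OF lim, of "\<lambda>j. 2 * j + 2"] by (simp add: o_def strict_mono_def)
  next
    case (6 j)
    then show ?case by (simp add: power2_eq_square algebra_simps)
  next
    case 14
    have "(\<lambda>j. (f (int (2 * Suc j)))\<^sup>2) sums (- (f (int 0))\<^sup>2 / 2)"
      by (rule sums_even_part[OF par]) (use odd in simp)
    then have "(\<lambda>j. (f (int (2 * j + 2)))\<^sup>2) sums 0" using f0 by (simp add: add.commute)
    then show ?case using sums_Suc_iff[of "\<lambda>j. (f (int (2 * j + 2)))\<^sup>2" "- (f 2)\<^sup>2"] by simp
  qed (use a a2 in \<open>auto simp: power2_eq_square\<close>)
  then have "f (int (2 * j + 2)) = 0" for j by (rule mathieu_coeffs.coeffs_zero)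
  then have "f (int (2 * j)) = 0" for j using f0 by (cases j) (auto simp: add.commute)
  then show ?thesis using odd by (cases "even n") (auto elim!: evenE)
qed

text \<open>A symmetric sine series has only odd frequencies, an antisymmetric one only even
  frequencies; Parseval turns \<open>iso\<close> into a relation between squares of
  coefficients.\<close>

lemma dirichlet_isotropic_zero:
  assumes sol: "mathieu_solution a \<mu> y y'" and bc: "y 0 = 0" "y pi = 0"
    and a: "0 < cmod a" "cmod a \<le> 8 / sqrt 6"
    and parity: "(\<forall>x\<in>{0..pi}. y (pi - x) = y x) \<or> (\<forall>x\<in>{0..pi}. y (pi - x) = - y x)"
    and iso: "integral {0..pi} (\<lambda>x. (y x)\<^sup>2) = 0" and x: "x \<in> {0..pi}"
  shows "y x = 0"
proof -
  note rec = dirichlet_recurrence[OF sol bc]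
  note summ = dirichlet_summable[OF sol bc]
  have lim: "(\<lambda>n. coef sin_mode y (int n)) \<longlonglongrightarrow> 0"
    using summable_LIMSEQ_zero[OF summ] tendsto_norm_zero_iff by blast
  have par: "(\<lambda>n. of_real (mode_weight n) * (coef sin_mode y (int n))\<^sup>2) sums 0"
    using parseval_sin[OF mathieu_solution_continuous(1)[OF sol] summ] iso by simp
  have "coef sin_mode y (int n) = 0" for n
    using parity
  proof
    assume "\<forall>x\<in>{0..pi}. y (pi - x) = y x"
    then have "coef sin_mode y n = 0" if "even n" for n
      using that by (intro coef_reflect_zero) (simp add: modes_reflect)
    then show ?thesis
      using coef_minus(1)[of y 1] by (intro odd_coeffs_zero[OF rec a _ _ lim par, of "-1"]) auto
  next
    assume "\<forall>x\<in>{0..pi}. y (pi - x) = - y x"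
    then have "coef sin_mode y n = 0" if "odd n" for n
      using that by (intro coef_reflect_zero) (simp add: modes_reflect)
    then show ?thesis
      using coef_minus(1)[of y 0] by (intro even_sin_coeffs_zero[OF rec a _ lim par]) auto
  qed
  then show ?thesis using dirichlet_coef_zero[OF sol bc _ x] by blast
qed

text \<open>Antisymmetric cosine series have odd frequencies. Symmetric ones have even frequencies,
  including the constant mode, and therefore need the smaller bound.\<close>

lemma neumann_isotropic_zero:
  assumes sol: "mathieu_solution a \<mu> y y'" and bc: "y' 0 = 0" "y' pi = 0"
    and a: "0 < cmod a"
    and parity: "(\<forall>x\<in>{0..pi}. y (pi - x) = - y x) \<and> cmod a \<le> 8 / sqrt 6 \<or>
      (\<forall>x\<in>{0..pi}. y (pi - x) = y x) \<and> cmod a \<le> 4 / 3"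
    and iso: "integral {0..pi} (\<lambda>x. (y x)\<^sup>2) = 0" and x: "x \<in> {0..pi}"
  shows "y x = 0"
proof -
  note rec = neumann_recurrence[OF sol bc]
  note summ = neumann_summable[OF sol bc]
  have lim: "(\<lambda>n. coef cos_mode y (int n)) \<longlonglongrightarrow> 0"
    using summable_LIMSEQ_zero[OF summ] tendsto_norm_zero_iff by blast
  have par: "(\<lambda>n. of_real (mode_weight n) * (coef cos_mode y (int n))\<^sup>2) sums 0"
    using parseval_cos[OF mathieu_solution_continuous(1)[OF sol] summ] iso by simp
  have "coef cos_mode y (int n) = 0" for n
    using parity
  proof
    assume *: "(\<forall>x\<in>{0..pi}. y (pi - x) = - y x) \<and> cmod a \<le> 8 / sqrt 6"
    then have "coef cos_mode y n = 0" if "even n" for n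
      using that by (intro coef_reflect_zero) (simp add: modes_reflect)
    then show ?thesis
      using coef_minus(2)[of y 1] * by (intro odd_coeffs_zero[OF rec a _ _ _ lim par, of 1]) auto
  next
    assume *: "(\<forall>x\<in>{0..pi}. y (pi - x) = y x) \<and> cmod a \<le> 4 / 3"
    then have "coef cos_mode y n = 0" if "odd n" for n
      using that by (intro coef_reflect_zero) (simp add: modes_reflect)
    then show ?thesis
      using coef_minus(2)[of y 2] * by (intro even_cos_coeffs_zero[OF rec a _ _ lim par]) auto
  qed
  then show ?thesis using neumann_coef_zero[OF sol _ x] by blast
qed

section \<open>Ince's theorem: Dirichlet and Neumann solutions do not coexist\<close>

lemma mathieu_recurrence_zero:
  assumes rec: "mathieu_recurrence a \<mu> f" and a: "a \<noteq> 0" and init: "f m = 0" "f (m + 2) = 0"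
  shows "f (m + 2 * int j) = 0"
proof -
  have "f (m + 2 * int j) = 0 \<and> f (m + 2 * int (Suc j)) = 0"
  proof (induction j)
    case (Suc j)
    have "a * f (m + 2 * int (Suc (Suc j))) = 0"
      using rec[unfolded mathieu_recurrence_def, rule_format, of "m + 2 * int (Suc j)"] Suc.IH
      by (simp add: algebra_simps)
    then show ?case using Suc.IH a by simp
  qed (use init in simp)
  then show ?thesis by simp
qed

text \<open>Ince's argument: the discrete Wronskian of two decaying solutions of the recurrence is
  constant along every second index, hence zero.\<close>

lemma discrete_wronskian_zero:
  assumes f: "mathieu_recurrence a \<mu> f" and g: "mathieu_recurrence a \<mu> g" and a: "a \<noteq> 0"
    and limf: "(\<lambda>n. f (int n)) \<longlonglongrightarrow> 0" and limg: "(\<lambda>n. g (int n)) \<longlonglongrightarrow> 0" and m: "m \<ge> -2"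
  shows "f m * g (m + 2) = f (m + 2) * g m"
proof -
  define W where "W n = f n * g (n + 2) - f (n + 2) * g n" for n
  have step: "W (n + 2) = W n" for n
  proof -
    have F: "a * (f n + f (n + 4)) = - (((of_int (n + 2))\<^sup>2 - \<mu>) * f (n + 2))"
      using f[unfolded mathieu_recurrence_def, rule_format, of "n + 2"] by (simp add: eq_neg_iff_add_eq_0 add.commute)
    have G: "a * (g n + g (n + 4)) = - (((of_int (n + 2))\<^sup>2 - \<mu>) * g (n + 2))"
      using g[unfolded mathieu_recurrence_def, rule_format, of "n + 2"] by (simp add: eq_neg_iff_add_eq_0 add.commute)
    have "a * (W (n + 2) - W n) = f (n + 2) * (a * (g n + g (n + 4))) - g (n + 2) * (a * (f n + f (n + 4)))"
      by (simp add: W_def algebra_simps)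
    also have "\<dots> = 0" unfolding F G by (simp add: algebra_simps)
    finally show ?thesis using a by simp
  qed
  have const: "W (m + 2 * int j) = W m" for j
  proof (induction j)
    case (Suc j)
    then show ?case using step[of "m + 2 * int j"] by (simp add: algebra_simps)
  qed simp
  have sub: "(\<lambda>j. h (m + 2 * int (Suc j))) \<longlonglongrightarrow> 0" if "(\<lambda>n. h (int n)) \<longlonglongrightarrow> 0" for h :: "int \<Rightarrow> complex"
  proof -
    \<comment> \<open>From \<open>m \<ge> -2\<close>, all indices \<open>m + 2 * int (Suc j)\<close>
      are nonnegative, where the limits are known.\<close>
    have "strict_mono (\<lambda>j. nat (m + 2 * int (Suc j)))" using m by (auto simp: strict_mono_def)
    from LIMSEQ_subseq_LIMSEQ[OF that this] show ?thesis using m by (simp add: o_def)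
  qed
  have "(\<lambda>j. W (m + 2 * int (Suc j))) \<longlonglongrightarrow> 0 * 0 - 0 * 0"
  proof -
    have *: "W (m + 2 * int (Suc j)) = f (m + 2 * int (Suc j)) * g (m + 2 * int (Suc (Suc j)))
        - f (m + 2 * int (Suc (Suc j))) * g (m + 2 * int (Suc j))" for j
      by (simp add: W_def algebra_simps)
    show ?thesis unfolding *
      by (intro tendsto_intros sub limf limg LIMSEQ_Suc[OF sub[OF limf]] LIMSEQ_Suc[OF sub[OF limg]])
  qed
  then have "(\<lambda>j. W m) \<longlonglongrightarrow> 0" unfolding const by simp
  then have "W m = 0" by (simp add: LIMSEQ_const_iff)
  then show ?thesis by (simp add: W_def)
qed

text \<open>The parities are paired so that both series live on the same class of frequencies modulo
  2. The vanishing Wronskian at the lowest index makes one series start with two zeros, and the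
  recurrence does the rest.\<close>

lemma no_coexistence:
  assumes sol1: "mathieu_solution a \<mu> y y'" and bc1: "y 0 = 0" "y pi = 0"
    and sol2: "mathieu_solution a \<mu> z z'" and bc2: "z' 0 = 0" "z' pi = 0" and a: "a \<noteq> 0"
    and parity: "(\<forall>x\<in>{0..pi}. y (pi - x) = y x) \<and> (\<forall>x\<in>{0..pi}. z (pi - x) = - z x) \<or>
      (\<forall>x\<in>{0..pi}. y (pi - x) = - y x) \<and> (\<forall>x\<in>{0..pi}. z (pi - x) = z x)"
  shows "(\<forall>x\<in>{0..pi}. y x = 0) \<or> (\<forall>x\<in>{0..pi}. z x = 0)"
proof -
  define f where "f = coef sin_mode y"
  define g where "g = coef cos_mode z"
  have f: "mathieu_recurrence a \<mu> f" unfolding f_def by (rule dirichlet_recurrence[OF sol1 bc1])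
  have g: "mathieu_recurrence a \<mu> g" unfolding g_def by (rule neumann_recurrence[OF sol2 bc2])
  have limf: "(\<lambda>n. f (int n)) \<longlonglongrightarrow> 0"
    using summable_LIMSEQ_zero[OF dirichlet_summable[OF sol1 bc1]] tendsto_norm_zero_iff unfolding f_def by blast
  have limg: "(\<lambda>n. g (int n)) \<longlonglongrightarrow> 0"
    using summable_LIMSEQ_zero[OF neumann_summable[OF sol2 bc2]] tendsto_norm_zero_iff unfolding g_def by blast
  have fm: "f (- n) = - f n" and gm: "g (- n) = g n" for n
    by (simp_all add: f_def g_def coef_minus)
  have "(\<forall>n. f (int n) = 0) \<or> (\<forall>n. g (int n) = 0)"
    using parity
  proof
    assume p: "(\<forall>x\<in>{0..pi}. y (pi - x) = y x) \<and> (\<forall>x\<in>{0..pi}. z (pi - x) = - z x)"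
    have ev: "f n = 0" "g n = 0" if "even n" for n
      using p that unfolding f_def g_def by (auto intro!: coef_reflect_zero simp: modes_reflect)
    have odd_zero: "\<forall>n. h (int n) = 0" if h: "mathieu_recurrence a \<mu> h" "h (-1) = 0" "h 1 = 0" "\<And>n. even n \<Longrightarrow> h n = 0" for h
    proof
      fix n
      show "h (int n) = 0"
      proof (cases "even n")
        case False
        then obtain j where "n = 2 * j + 1" by (auto elim: oddE)
        then show ?thesis using mathieu_recurrence_zero[OF h(1) a, of "-1" "Suc j"] h(2,3) by (simp add: algebra_simps)
      qed (use h(4) in simp)
    qed
    \<comment> \<open>At index -1 the Wronskian identity reads
      \<open>- f 1 * g 1 = f 1 * g 1\<close>, as sine coefficients are odd and cosine coefficients
      even in the index.\<close>
    have "f 1 * g 1 = 0"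
      using discrete_wronskian_zero[OF f g a limf limg, of "-1"] fm[of 1] gm[of 1] by simp
    then show ?thesis
      using odd_zero[OF f] odd_zero[OF g] fm[of 1] gm[of 1] ev by (auto simp: mult_eq_0_iff)
  next
    assume p: "(\<forall>x\<in>{0..pi}. y (pi - x) = - y x) \<and> (\<forall>x\<in>{0..pi}. z (pi - x) = z x)"
    have od: "f n = 0" "g n = 0" if "odd n" for n
      using p that unfolding f_def g_def by (auto intro!: coef_reflect_zero simp: modes_reflect)
    have even_zero: "\<forall>n. h (int n) = 0" if h: "mathieu_recurrence a \<mu> h" "h 0 = 0" "h 2 = 0" "\<And>n. odd n \<Longrightarrow> h n = 0" for h
    proof
      fix n
      show "h (int n) = 0"
      proof (cases "even n")
        case True
        then obtain j where "n = 2 * j" by (auto elim: evenE)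
        then show ?thesis using mathieu_recurrence_zero[OF h(1) a, of 0 j] h(2,3) by simp
      qed (use h(4) in simp)
    qed
    have f0: "f 0 = 0" using fm[of 0] by simp
    \<comment> \<open>If \<open>f 2 = 0\<close>, then \<open>f\<close> has two zeros together with
      \<open>f 0\<close>; if \<open>g 0 = 0\<close>, row 0 reads
      \<open>2 * a * g 2 = 0\<close>.\<close>
    have "f 2 * g 0 = 0" using discrete_wronskian_zero[OF f g a limf limg, of 0] f0 by simp
    moreover have "g 2 = 0" if "g 0 = 0"
      using g[unfolded mathieu_recurrence_def, rule_format, of 0] gm[of 2] that a by simp
    ultimately show ?thesis
      using even_zero[OF f f0] even_zero[OF g] od by (auto simp: mult_eq_0_iff)
  qed
  then show ?thesis
    using dirichlet_coef_zero[OF sol1 bc1] neumann_coef_zero[OF sol2] unfolding f_def g_def by blast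
qed


section \<open>The operators\<close>

lemma deriv0pi_eq:
  assumes "(y has_vector_derivative d) (at x within {0..pi})" "x \<in> {0..pi}"
  shows "deriv0pi y x = d"
  using vector_derivative_within_closed_interval[OF pi_gt_zero assms(2,1)] .

section \<open>From elements of the operator domain to classical solutions\<close>

lemma continuous_L2: "continuous_on {0..pi} f \<Longrightarrow> f \<in> L2"
  unfolding L2_def
  by (auto intro!: continuous_imp_measurable_on_sets_lebesgue continuous_imp_integrable_real continuous_intros)

text \<open>The indefinite integral does not see the null set where \<open>v\<close> and
  \<open>w\<close> differ, so \<open>y'\<close> is an integral of a continuous function and
  differentiable everywhere.\<close>

lemma second_deriv_continuous:
  assumes y: "has_second_deriv y v" and w: "continuous_on {0..pi} w"
    and ae: "AE x in lebesgue_on {0..pi}. v x = w x"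
  shows "twice_deriv y (deriv0pi y) w"
proof -
  have vm: "(\<lambda>t. indicator {0..pi} t *\<^sub>R v t) \<in> borel_measurable lebesgue"
    using y unfolding has_second_deriv_def L2_def by (simp add: borel_measurable_restrict_space_iff)
  have wm: "(\<lambda>t. indicator {0..pi} t *\<^sub>R w t) \<in> borel_measurable lebesgue"
    using continuous_imp_measurable_on_sets_lebesgue[OF w] by (simp add: borel_measurable_restrict_space_iff)
  have ae': "AE t in lebesgue. t \<in> {0..pi} \<longrightarrow> v t = w t"
    using ae by (subst (asm) AE_restrict_space_iff) auto
  have y': "deriv0pi y x = deriv0pi y 0 + integral {0..x} w" if x: "x \<in> {0..pi}" for x
  proof -
    \<comment> \<open>Measurability of \<open>v\<close> is known on \<open>{0..pi}\<close> only, so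
      the smaller indicator is factored through the larger one.\<close>
    have ind: "indicator {0..x} t *\<^sub>R h t = indicator {0..x} t *\<^sub>R (indicator {0..pi} t *\<^sub>R h t)" for t and h :: "real \<Rightarrow> complex"
      using x by (auto simp: indicator_def)
    have wc: "continuous_on {0..x} w" using w by (rule continuous_on_subset) (use x in auto)
    have "(LINT t:{0..x}|lebesgue. v t) = (LINT t:{0..x}|lebesgue. w t)"
      unfolding set_lebesgue_integral_def
    proof (rule integral_cong_AE)
      show "(\<lambda>t. indicator {0..x} t *\<^sub>R v t) \<in> borel_measurable lebesgue"
        by (subst ind) (intro borel_measurable_scaleR borel_measurable_indicator vm, simp)
      show "(\<lambda>t. indicator {0..x} t *\<^sub>R w t) \<in> borel_measurable lebesgue"
        by (subst ind) (intro borel_measurable_scaleR borel_measurable_indicator wm, simp)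
      show "AE t in lebesgue. indicator {0..x} t *\<^sub>R v t = indicator {0..x} t *\<^sub>R w t"
        using ae' by eventually_elim (use x in \<open>auto simp: indicator_def\<close>)
    qed
    also have "\<dots> = integral {0..x} w"
      by (intro set_lebesgue_integral_eq_integral absolutely_integrable_continuous_real wc)
    finally have "(LINT t:{0..x}|lebesgue. v t) = integral {0..x} w" .
    moreover have "deriv0pi y x = deriv0pi y 0 + (LINT t:{0..x}|lebesgue. v t)"
      using y x unfolding has_second_deriv_def by blast
    ultimately show ?thesis by (rule subst)
  qed
  show ?thesis
    unfolding twice_deriv_def
  proof (intro ballI conjI)
    fix x assume x: "x \<in> {0..pi}"
    show "(y has_vector_derivative deriv0pi y x) (at x within {0..pi})"
      using y x unfolding has_second_deriv_def vector_derivative_works by blast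
    have "((\<lambda>x. deriv0pi y 0 + integral {0..x} w) has_vector_derivative 0 + w x) (at x within {0..pi})"
      by (intro has_vector_derivative_add has_vector_derivative_const integral_has_vector_derivative w x)
    then have I: "((\<lambda>x. deriv0pi y 0 + integral {0..x} w) has_vector_derivative w x) (at x within {0..pi})"
      by simp
    show "(deriv0pi y has_vector_derivative w x) (at x within {0..pi})"
      by (rule has_vector_derivative_transform[where g = "deriv0pi y", OF x _ I]) (rule y')
  qed
qed

lemma mathieu_potential_continuous: "continuous_on S (mathieu_potential a)"
  unfolding mathieu_potential_def by (intro continuous_intros)

text \<open>Continuity of \<open>f\<close> is asked for conditionally because in the applications
  \<open>f\<close> is built from \<open>y\<close>, whose continuity is only established inside the
  proof.\<close>

lemma sl_operatorD:
  assumes yf: "(y, f) \<in> sl_operator (mathieu_potential a) B"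
    and f: "continuous_on {0..pi} y \<Longrightarrow> continuous_on {0..pi} f"
  shows "\<And>x. x \<notin> {0..pi} \<Longrightarrow> y x = 0" and "B y (deriv0pi y)"
    and "twice_deriv y (deriv0pi y) (\<lambda>x. mathieu_potential a x * y x - f x)"
proof -
  obtain v where v: "has_second_deriv y v" "AE x in lebesgue_on {0..pi}. f x = - v x + mathieu_potential a x * y x"
    using yf unfolding sl_operator_def by auto
  have y: "continuous_on {0..pi} y"
    using v(1) unfolding has_second_deriv_def
    by (auto intro!: differentiable_imp_continuous_within simp: continuous_on_eq_continuous_within)
  show "twice_deriv y (deriv0pi y) (\<lambda>x. mathieu_potential a x * y x - f x)"
  proof (rule second_deriv_continuous[OF v(1)])
    show "AE x in lebesgue_on {0..pi}. v x = mathieu_potential a x * y x - f x"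
      using v(2) by eventually_elim simp
  qed (intro continuous_intros mathieu_potential_continuous y f)
  show "\<And>x. x \<notin> {0..pi} \<Longrightarrow> y x = 0" "B y (deriv0pi y)"
    using yf unfolding sl_operator_def by auto
qed

lemma sl_operatorI:
  assumes y: "twice_deriv y (deriv0pi y) (\<lambda>x. mathieu_potential a x * y x - f x)"
    and f: "continuous_on {0..pi} f" and B: "B y (deriv0pi y)" and out: "\<And>x. x \<notin> {0..pi} \<Longrightarrow> y x = 0"
  shows "(y, f) \<in> sl_operator (mathieu_potential a) B"
proof -
  define w where "w x = mathieu_potential a x * y x - f x" for x
  note y = y[folded w_def]
  have w: "continuous_on {0..pi} w"
    unfolding w_def by (intro continuous_intros mathieu_potential_continuous f twice_deriv_continuous(1)[OF y])
  have "has_second_deriv y w"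
    unfolding has_second_deriv_def
  proof (intro conjI ballI)
    fix x assume x: "x \<in> {0..pi}"
    show "y differentiable (at x within {0..pi})"
      using y x unfolding twice_deriv_def by (auto intro: differentiableI_vector)
    have sub: "{0..x} \<subseteq> {0..pi}" using x by auto
    have "(w has_integral deriv0pi y x - deriv0pi y 0) {0..x}"
    proof (rule fundamental_theorem_of_calculus)
      fix t assume "t \<in> {0..x}"
      then have "(deriv0pi y has_vector_derivative w t) (at t within {0..pi})"
        using y sub unfolding twice_deriv_def by blast
      then show "(deriv0pi y has_vector_derivative w t) (at t within {0..x})"
        using sub by (rule has_vector_derivative_within_subset)
    qed (use x in simp)
    moreover have "(LINT t:{0..x}|lebesgue. w t) = integral {0..x} w"
      by (intro set_lebesgue_integral_eq_integral absolutely_integrable_continuous_real continuous_on_subset[OF w] sub)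
    ultimately show "deriv0pi y x = deriv0pi y 0 + (LINT t:{0..x}|lebesgue. w t)"
      by (simp add: integral_unique)
  qed (rule continuous_L2[OF w])
  then show ?thesis
    unfolding sl_operator_def using B out continuous_L2[OF f] by (auto simp: w_def intro!: exI[of _ w])
qed

text \<open>An associated function would satisfy \<open>(T - \<mu>) y = \<kappa> * y0\<close>;
  pairing with \<open>y0\<close> gives \<kappa> times the integral of the square of
  \<open>y0\<close> equal to 0. So no chain is longer than 1 and all root spaces lie in the line
  through \<open>y0\<close>.\<close>

lemma simple_eigenvalueI:
  fixes B :: boundary_condition
  assumes scale: "\<And>y y' z' \<kappa>. B y y' \<Longrightarrow> z' 0 = \<kappa> * y' 0 \<Longrightarrow> z' pi = \<kappa> * y' pi \<Longrightarrow> B (\<lambda>x. \<kappa> * y x) z'"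
    and symmetric: "\<And>y y' z z'. B y y' \<Longrightarrow> B z z' \<Longrightarrow>
      y' pi * z pi - y pi * z' pi = y' 0 * z 0 - y 0 * z' 0"
    and one_dim: "\<And>y y' z z'. mathieu_solution a \<mu> y y' \<Longrightarrow> B y y' \<Longrightarrow> mathieu_solution a \<mu> z z' \<Longrightarrow> B z z' \<Longrightarrow>
      \<exists>x\<in>{0..pi}. y x \<noteq> 0 \<Longrightarrow> \<exists>\<kappa>. \<forall>x\<in>{0..pi}. z x = \<kappa> * y x"
    and anisotropic: "\<And>y y'. mathieu_solution a \<mu> y y' \<Longrightarrow> B y y' \<Longrightarrow> \<exists>x\<in>{0..pi}. y x \<noteq> 0 \<Longrightarrow>
      integral {0..pi} (\<lambda>x. (y x)\<^sup>2) \<noteq> 0"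
    and ev: "eigenvalue (sl_operator (mathieu_potential a) B) \<mu>"
  shows "simple_eigenvalue (sl_operator (mathieu_potential a) B) \<mu>"
proof -
  define T where "T = sl_operator (mathieu_potential a) B"
  have eigen: "\<And>x. x \<notin> {0..pi} \<Longrightarrow> y x = 0" "B y (deriv0pi y)" "mathieu_solution a \<mu> y (deriv0pi y)"
    if "(y, \<lambda>x. \<mu> * y x) \<in> T" for y
  proof -
    have "continuous_on {0..pi} (\<lambda>x. \<mu> * y x)" if "continuous_on {0..pi} y"
      using that by (intro continuous_intros)
    note d = sl_operatorD[OF that[unfolded T_def] this]
    show "\<And>x. x \<notin> {0..pi} \<Longrightarrow> y x = 0" by (rule d(1))
    show "B y (deriv0pi y)" by (rule d(2))
    show "mathieu_solution a \<mu> y (deriv0pi y)"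
      using d(3) unfolding mathieu_solution_def left_diff_distrib .
  qed
  obtain y0 where y0: "y0 \<noteq> (\<lambda>_. 0)" "(y0, \<lambda>x. \<mu> * y0 x) \<in> T"
    using ev[folded T_def] unfolding eigenvalue_def by (elim exE conjE) (rule that)
  note y0' = eigen[OF y0(2)]
  have nz: "\<exists>x\<in>{0..pi}. y0 x \<noteq> 0" using y0(1) y0'(1) by (metis ext)
  have c0: "continuous_on {0..pi} y0" using mathieu_solution_continuous(1)[OF y0'(3)] .
  have line: "\<exists>\<kappa>. y = (\<lambda>x. \<kappa> * y0 x)" if y: "(y, \<lambda>x. \<mu> * y x) \<in> T" for y
  proof -
    obtain \<kappa> where "\<forall>x\<in>{0..pi}. y x = \<kappa> * y0 x"
      using one_dim[OF y0'(3,2) eigen(3,2)[OF y] nz] by blast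
    then have "y x = \<kappa> * y0 x" for x using eigen(1)[OF y, of x] y0'(1)[of x] by (cases "x \<in> {0..pi}") auto
    then show ?thesis by blast
  qed
  have multiple: "((\<lambda>x. \<kappa> * y0 x), \<lambda>x. \<mu> * (\<kappa> * y0 x)) \<in> T" for \<kappa>
    unfolding T_def
  proof (rule sl_operatorI)
    have sol: "mathieu_solution a \<mu> (\<lambda>x. \<kappa> * y0 x) (\<lambda>x. \<kappa> * deriv0pi y0 x)"
      using mathieu_solution_lincomb[OF y0'(3,3), of \<kappa> 0] by simp
    have d: "deriv0pi (\<lambda>x. \<kappa> * y0 x) x = \<kappa> * deriv0pi y0 x" if "x \<in> {0..pi}" for x
      using sol that unfolding mathieu_solution_def twice_deriv_def by (intro deriv0pi_eq) auto
    \<comment> \<open>The derivative of the multiple is only determined on \<open>{0..pi}\<close>,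
      which is why \<open>scale\<close> speaks of endpoint values alone.\<close>
    show "B (\<lambda>x. \<kappa> * y0 x) (deriv0pi (\<lambda>x. \<kappa> * y0 x))" using y0'(2) by (rule scale) (simp_all add: d)
    show "twice_deriv (\<lambda>x. \<kappa> * y0 x) (deriv0pi (\<lambda>x. \<kappa> * y0 x)) (\<lambda>x. mathieu_potential a x * (\<kappa> * y0 x) - \<mu> * (\<kappa> * y0 x))"
      using sol unfolding mathieu_solution_def twice_deriv_def
      by (auto simp: d left_diff_distrib intro: has_vector_derivative_transform[OF _ d])
  qed (use y0'(1) in \<open>auto intro!: continuous_intros c0\<close>)
  have no_assoc: "\<kappa> = 0" if y: "(y, \<lambda>x. \<mu> * y x + \<kappa> * y0 x) \<in> T" for y \<kappa>
  proof -
    have "continuous_on {0..pi} (\<lambda>x. \<mu> * y x + \<kappa> * y0 x)" if "continuous_on {0..pi} y"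
      using that c0 by (intro continuous_intros)
    note y' = sl_operatorD[OF y[unfolded T_def] this]
    have "((\<lambda>x. (mathieu_potential a x * y x - (\<mu> * y x + \<kappa> * y0 x)) * y0 x - y x * ((mathieu_potential a x - \<mu>) * y0 x)) has_integral
      (deriv0pi y pi * y0 pi - y pi * deriv0pi y0 pi) - (deriv0pi y 0 * y0 0 - y 0 * deriv0pi y0 0)) {0..pi}"
      by (rule green[OF y'(3) y0'(3)[unfolded mathieu_solution_def]])
    moreover have "(deriv0pi y pi * y0 pi - y pi * deriv0pi y0 pi) - (deriv0pi y 0 * y0 0 - y 0 * deriv0pi y0 0) = 0"
      using symmetric[OF y'(2) y0'(2)] by simp
    moreover have "(mathieu_potential a x * y x - (\<mu> * y x + \<kappa> * y0 x)) * y0 x - y x * ((mathieu_potential a x - \<mu>) * y0 x) = - \<kappa> * (y0 x)\<^sup>2" for x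
      by (simp add: algebra_simps power2_eq_square)
    ultimately have "((\<lambda>x. - \<kappa> * (y0 x)\<^sup>2) has_integral 0) {0..pi}" by simp
    then have "- \<kappa> * integral {0..pi} (\<lambda>x. (y0 x)\<^sup>2) = 0"
      by (metis integral_mult_right integral_unique)
    then show ?thesis using anisotropic[OF y0'(3,2) nz] by simp
  qed
  have sub: "root_space T \<mu> n \<subseteq> range (\<lambda>\<kappa> x. \<kappa> * y0 x)" for n
  proof (induction n)
    case 0
    have "(\<lambda>_. 0) = (\<lambda>x. 0 * y0 x)" by simp
    then have "(\<lambda>_. 0) \<in> range (\<lambda>\<kappa> x. \<kappa> * y0 x)" by (rule range_eqI)
    then show ?case by simp
  next
    case (Suc n)
    show ?case
    proof
      fix y assume "y \<in> root_space T \<mu> (Suc n)"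
      \<comment> \<open>By induction the image under \<open>T - \<mu>\<close> is a multiple of
        \<open>y0\<close>; \<open>no_assoc\<close> makes it zero, so \<open>y\<close> is itself in
        the eigenspace.\<close>
      then obtain \<kappa> where y: "(y, \<lambda>x. \<mu> * y x + \<kappa> * y0 x) \<in> T" using Suc.IH by auto
      then have "\<kappa> = 0" by (rule no_assoc)
      then have "(y, \<lambda>x. \<mu> * y x) \<in> T" using y by simp
      then show "y \<in> range (\<lambda>\<kappa> x. \<kappa> * y0 x)" using line by blast
    qed
  qed
  have sup: "(\<lambda>x. \<kappa> * y0 x) \<in> root_space T \<mu> (Suc 0)" for \<kappa>
    using multiple[of \<kappa>] by simp
  have "(\<Union>n. root_space T \<mu> n) = range (\<lambda>\<kappa> x. \<kappa> * y0 x)"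
    using sub sup by blast
  moreover have "cfun.dim (range (\<lambda>\<kappa> x. \<kappa> * y0 x)) = 1"
  proof (rule cfun.dim_unique)
    show "{y0} \<subseteq> range (\<lambda>\<kappa> x. \<kappa> * y0 x)" by (auto intro!: range_eqI[of _ _ 1])
    have "(\<lambda>x. \<kappa> * y0 x) \<in> cfun.span {y0}" for \<kappa>
      by (rule cfun.span_scale) (simp add: cfun.span_base)
    then show "range (\<lambda>\<kappa> x. \<kappa> * y0 x) \<subseteq> cfun.span {y0}" by blast
    show "cfun.independent {y0}" using y0(1) by (simp add: zero_fun_def)
  qed simp
  ultimately show ?thesis
    using ev unfolding simple_eigenvalue_def alg_multiplicity_def T_def by simp
qed

section \<open>One-dimensional eigenspaces and the four operators\<close>

lemma dirichlet_proportional: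
  assumes y: "mathieu_solution a \<mu> y y'" and z: "mathieu_solution a \<mu> z z'"
    and "y 0 = 0" "z 0 = 0" and nz: "\<exists>x\<in>{0..pi}. y x \<noteq> 0"
  shows "\<exists>\<kappa>. \<forall>x\<in>{0..pi}. z x = \<kappa> * y x"
proof -
  \<comment> \<open>Otherwise both initial values vanish and \<open>y\<close> is zero by
    uniqueness.\<close>
  have y'0: "y' 0 \<noteq> 0" using mathieu_solution_unique[OF y] assms by blast
  define \<kappa> where "\<kappa> = z' 0 / y' 0"
  have "1 * z x + (- \<kappa>) * y x = 0" if "x \<in> {0..pi}" for x
    by (rule mathieu_solution_unique[OF mathieu_solution_lincomb[OF z y, of 1 "- \<kappa>"] _ _ that])
      (use assms y'0 in \<open>auto simp: \<kappa>_def\<close>)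
  then show ?thesis by (intro exI[of _ \<kappa>]) simp
qed

lemma neumann_proportional:
  assumes y: "mathieu_solution a \<mu> y y'" and z: "mathieu_solution a \<mu> z z'"
    and "y' 0 = 0" "z' 0 = 0" and nz: "\<exists>x\<in>{0..pi}. y x \<noteq> 0"
  shows "\<exists>\<kappa>. \<forall>x\<in>{0..pi}. z x = \<kappa> * y x"
proof -
  have y0: "y 0 \<noteq> 0" using mathieu_solution_unique[OF y] assms by blast
  define \<kappa> where "\<kappa> = z 0 / y 0"
  have "1 * z x + (- \<kappa>) * y x = 0" if "x \<in> {0..pi}" for x
    by (rule mathieu_solution_unique[OF mathieu_solution_lincomb[OF z y, of 1 "- \<kappa>"] _ _ that])
      (use assms y0 in \<open>auto simp: \<kappa>_def\<close>)
  then show ?thesis by (intro exI[of _ \<kappa>]) simp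
qed

text \<open>Reflection is an involution, so the factor squares to 1.\<close>

lemma parity_of_proportional_reflection:
  fixes y :: "real \<Rightarrow> complex"
  assumes \<kappa>: "\<forall>x\<in>{0..pi}. y (pi - x) = \<kappa> * y x" and nz: "\<exists>x\<in>{0..pi}. y x \<noteq> 0"
  shows "(\<forall>x\<in>{0..pi}. y (pi - x) = y x) \<or> (\<forall>x\<in>{0..pi}. y (pi - x) = - y x)"
proof -
  obtain x where x: "x \<in> {0..pi}" "y x \<noteq> 0" using nz by blast
  have "y x = \<kappa> * y (pi - x)" using \<kappa>[rule_format, of "pi - x"] x(1) by simp
  also have "\<dots> = \<kappa> * \<kappa> * y x" using \<kappa> x(1) by simp
  finally have "\<kappa> * \<kappa> = 1" using x(2) by simp
  then have "\<kappa> = 1 \<or> \<kappa> = - 1" by (simp add: square_eq_1_iff)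
  then show ?thesis using \<kappa> by auto
qed

lemma four_thirds_le: "4 / 3 \<le> 8 / sqrt 6"
proof -
  have "sqrt 6 \<le> 3" by (rule real_le_lsqrt) auto
  then have "8 / 3 \<le> 8 / sqrt 6" by (intro divide_left_mono) auto
  then show ?thesis by linarith
qed

lemma dirichlet_simple:
  assumes a: "0 < cmod a" "cmod a \<le> 8 / sqrt 6" and ev: "eigenvalue (D_op a) \<mu>"
  shows "simple_eigenvalue (D_op a) \<mu>"
  using ev unfolding D_op_def
proof (rule simple_eigenvalueI[rotated -1])
  fix y y' assume sol: "mathieu_solution a \<mu> y y'" and bc: "dirichlet_bc y y'" and nz: "\<exists>x\<in>{0..pi}. y x \<noteq> 0"
  \<comment> \<open>The reflected solution satisfies the same boundary condition and eigenvalue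
    equation, hence is a multiple of \<open>y\<close>.\<close>
  obtain \<kappa> where "\<forall>x\<in>{0..pi}. y (pi - x) = \<kappa> * y x"
    using dirichlet_proportional[OF sol mathieu_solution_reflect[OF sol] _ _ nz] bc by (auto simp: dirichlet_bc_def)
  from parity_of_proportional_reflection[OF this nz]
  show "integral {0..pi} (\<lambda>x. (y x)\<^sup>2) \<noteq> 0"
    using dirichlet_isotropic_zero[OF sol _ _ a] bc nz by (auto simp: dirichlet_bc_def)
next
  fix y y' z z' assume "mathieu_solution a \<mu> y y'" "dirichlet_bc y y'" "mathieu_solution a \<mu> z z'" "dirichlet_bc z z'"
    "\<exists>x\<in>{0..pi}. y x \<noteq> 0"
  then show "\<exists>\<kappa>. \<forall>x\<in>{0..pi}. z x = \<kappa> * y x"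
    using dirichlet_proportional by (auto simp: dirichlet_bc_def)
qed (auto simp: dirichlet_bc_def)

lemma neumann_simple:
  assumes a: "0 < cmod a" "cmod a \<le> 4 / 3" and ev: "eigenvalue (N_op a) \<mu>"
  shows "simple_eigenvalue (N_op a) \<mu>"
  using ev unfolding N_op_def
proof (rule simple_eigenvalueI[rotated -1])
  have a': "cmod a \<le> 8 / sqrt 6" using a four_thirds_le by linarith
  fix y y' assume sol: "mathieu_solution a \<mu> y y'" and bc: "neumann_bc y y'" and nz: "\<exists>x\<in>{0..pi}. y x \<noteq> 0"
  obtain \<kappa> where "\<forall>x\<in>{0..pi}. y (pi - x) = \<kappa> * y x"
    using neumann_proportional[OF sol mathieu_solution_reflect[OF sol] _ _ nz] bc by (auto simp: neumann_bc_def)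
  from parity_of_proportional_reflection[OF this nz]
  show "integral {0..pi} (\<lambda>x. (y x)\<^sup>2) \<noteq> 0"
    using neumann_isotropic_zero[OF sol _ _ a(1)] a(2) a' bc nz unfolding neumann_bc_def by blast
next
  fix y y' z z' assume "mathieu_solution a \<mu> y y'" "neumann_bc y y'" "mathieu_solution a \<mu> z z'" "neumann_bc z z'"
    "\<exists>x\<in>{0..pi}. y x \<noteq> 0"
  then show "\<exists>\<kappa>. \<forall>x\<in>{0..pi}. z x = \<kappa> * y x"
    using neumann_proportional by (auto simp: neumann_bc_def)
qed (auto simp: neumann_bc_def)

text \<open>\<open>\<sigma> = 1\<close> is the periodic, \<open>\<sigma> = -1\<close> the antiperiodic condition.\<close>

definition quasi_bc :: "complex \<Rightarrow> boundary_condition" where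
  "quasi_bc \<sigma> y y' \<longleftrightarrow> y pi = \<sigma> * y 0 \<and> y' pi = \<sigma> * y' 0"

text \<open>Coexistence is excluded even between parts of different eigenfunctions for the same
  \<mu>; so all of them are of Dirichlet type or all of Neumann type, and either type spans one
  dimension.\<close>

lemma quasi_simple:
  assumes a: "0 < cmod a" "\<sigma> = 1 \<and> cmod a \<le> 4 / 3 \<or> \<sigma> = - 1 \<and> cmod a \<le> 8 / sqrt 6"
    and ev: "eigenvalue (sl_operator (mathieu_potential a) (quasi_bc \<sigma>)) \<mu>"
  shows "simple_eigenvalue (sl_operator (mathieu_potential a) (quasi_bc \<sigma>)) \<mu>"
proof -
  have a': "cmod a \<le> 8 / sqrt 6" using a four_thirds_le by linarith
  have a0: "a \<noteq> 0" using a by auto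
  have \<sigma>\<sigma>: "\<sigma> * \<sigma> = 1" and \<sigma>: "\<sigma> = 1 \<or> \<sigma> = - 1" using a(2) by auto
  \<comment> \<open>Twice the Dirichlet part; the factor 1 fits the shape of
    \<open>mathieu_solution_lincomb\<close>.\<close>
  define D where "D y x = 1 * y x + (- \<sigma>) * y (pi - x)" for y :: "real \<Rightarrow> complex" and x
  define D' where "D' y' x = 1 * y' x + (- \<sigma>) * (- y' (pi - x))" for y' :: "real \<Rightarrow> complex" and x
  define N where "N y x = 1 * y x + \<sigma> * y (pi - x)" for y :: "real \<Rightarrow> complex" and x
  define N' where "N' y' x = 1 * y' x + \<sigma> * (- y' (pi - x))" for y' :: "real \<Rightarrow> complex" and x
  have half: "y x = (D y x + N y x) / 2" for y x by (simp add: D_def N_def)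
  have D: "mathieu_solution a \<mu> (D y) (D' y')" "D y 0 = 0" "D y pi = 0"
    and N: "mathieu_solution a \<mu> (N y) (N' y')" "N' y' 0 = 0" "N' y' pi = 0"
    if y: "mathieu_solution a \<mu> y y'" "quasi_bc \<sigma> y y'" for y y'
  proof -
    show "mathieu_solution a \<mu> (D y) (D' y')" "mathieu_solution a \<mu> (N y) (N' y')"
      unfolding D_def D'_def N_def N'_def
      by (intro mathieu_solution_lincomb mathieu_solution_reflect y(1))+
    show "D y 0 = 0" "D y pi = 0" "N' y' 0 = 0" "N' y' pi = 0"
      using y(2) \<sigma> by (auto simp: D_def N'_def quasi_bc_def)
  qed
  \<comment> \<open>These signs are the pairing required by \<open>no_coexistence\<close>; for
    \<sigma> = 1 the Neumann part is symmetric, which is where the bound 4/3 enters.\<close>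
  have D_refl: "D y (pi - x) = - \<sigma> * D y x" and N_refl: "N y (pi - x) = \<sigma> * N y x" for y x
    using \<sigma> by (auto simp: D_def N_def)
  have excl: "(\<forall>x\<in>{0..pi}. D y x = 0) \<or> (\<forall>x\<in>{0..pi}. N z x = 0)"
    if y: "mathieu_solution a \<mu> y y'" "quasi_bc \<sigma> y y'" and z: "mathieu_solution a \<mu> z z'" "quasi_bc \<sigma> z z'" for y y' z z'
    by (rule no_coexistence[OF D[OF y] N[OF z] a0]) (use \<sigma> D_refl N_refl in auto)
  have D_case: "y x = D y x / 2" if "\<forall>x\<in>{0..pi}. N y x = 0" "x \<in> {0..pi}" for y x
    using half[of y x] that by simp
  have N_case: "y x = N y x / 2" if "\<forall>x\<in>{0..pi}. D y x = 0" "x \<in> {0..pi}" for y x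
    using half[of y x] that by simp
  show ?thesis
    using ev
  proof (rule simple_eigenvalueI[rotated -1])
    fix y y' assume y: "mathieu_solution a \<mu> y y'" "quasi_bc \<sigma> y y'" and nz: "\<exists>x\<in>{0..pi}. y x \<noteq> 0"
    show "integral {0..pi} (\<lambda>x. (y x)\<^sup>2) \<noteq> 0"
    proof
      assume iso: "integral {0..pi} (\<lambda>x. (y x)\<^sup>2) = 0"
      show False
        using excl[OF y y]
      proof
        assume d: "\<forall>x\<in>{0..pi}. D y x = 0"
        have "integral {0..pi} (\<lambda>x. (N y x)\<^sup>2) = integral {0..pi} (\<lambda>x. 4 * (y x)\<^sup>2)"
          by (rule integral_cong) (simp add: N_case[OF d] power_divide)
        then have i0: "integral {0..pi} (\<lambda>x. (N y x)\<^sup>2) = 0" using iso by simp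
        have par: "(\<forall>x\<in>{0..pi}. N y (pi - x) = - N y x) \<and> cmod a \<le> 8 / sqrt 6 \<or>
            (\<forall>x\<in>{0..pi}. N y (pi - x) = N y x) \<and> cmod a \<le> 4 / 3"
          using a(2) N_refl[of y] by auto
        have "\<forall>x\<in>{0..pi}. N y x = 0"
          using neumann_isotropic_zero[OF N[OF y] a(1) par i0] by blast
        then show False using nz N_case[OF d] by auto
      next
        assume n: "\<forall>x\<in>{0..pi}. N y x = 0"
        have "integral {0..pi} (\<lambda>x. (D y x)\<^sup>2) = integral {0..pi} (\<lambda>x. 4 * (y x)\<^sup>2)"
          by (rule integral_cong) (simp add: D_case[OF n] power_divide)
        then have i0: "integral {0..pi} (\<lambda>x. (D y x)\<^sup>2) = 0" using iso by simp
        have par: "(\<forall>x\<in>{0..pi}. D y (pi - x) = D y x) \<or> (\<forall>x\<in>{0..pi}. D y (pi - x) = - D y x)"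
          using \<sigma> D_refl[of y] by auto
        have "\<forall>x\<in>{0..pi}. D y x = 0"
          using dirichlet_isotropic_zero[OF D[OF y] a(1) a' par i0] by blast
        then show False using nz D_case[OF n] by auto
      qed
    qed
  next
    fix y y' z z' assume y: "mathieu_solution a \<mu> y y'" "quasi_bc \<sigma> y y'"
      and z: "mathieu_solution a \<mu> z z'" "quasi_bc \<sigma> z z'" and nz: "\<exists>x\<in>{0..pi}. y x \<noteq> 0"
    show "\<exists>\<kappa>. \<forall>x\<in>{0..pi}. z x = \<kappa> * y x"
    proof (cases "\<forall>x\<in>{0..pi}. D y x = 0")
      case True
      then have ny: "\<exists>x\<in>{0..pi}. N y x \<noteq> 0" using nz N_case[OF True] by auto
      then have dz: "\<forall>x\<in>{0..pi}. D z x = 0" using excl[OF z y] by blast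
      obtain \<kappa> where \<kappa>: "\<forall>x\<in>{0..pi}. N z x = \<kappa> * N y x"
        using neumann_proportional[OF N(1)[OF y] N(1)[OF z] N(2)[OF y] N(2)[OF z] ny] by blast
      have "z x = \<kappa> * y x" if "x \<in> {0..pi}" for x
        unfolding N_case[OF True that] N_case[OF dz that] using \<kappa> that by simp
      then show ?thesis by blast
    next
      case False
      \<comment> \<open>The nonzero Dirichlet part of \<open>y\<close> forbids a Neumann part in
        \<open>y\<close> itself and in \<open>z\<close>.\<close>
      then have n: "\<forall>x\<in>{0..pi}. N y x = 0" "\<forall>x\<in>{0..pi}. N z x = 0" using excl[OF y y] excl[OF y z] by blast+
      have dy: "\<exists>x\<in>{0..pi}. D y x \<noteq> 0" using False by blast
      obtain \<kappa> where \<kappa>: "\<forall>x\<in>{0..pi}. D z x = \<kappa> * D y x"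
        using dirichlet_proportional[OF D(1)[OF y] D(1)[OF z] D(2)[OF y] D(2)[OF z] dy] by blast
      have "z x = \<kappa> * y x" if "x \<in> {0..pi}" for x
        unfolding D_case[OF n(1) that] D_case[OF n(2) that] using \<kappa> that by simp
      then show ?thesis by blast
    qed
  next
    fix y y' z z' assume "quasi_bc \<sigma> y y'" "quasi_bc \<sigma> z z'"
    then show "y' pi * z pi - y pi * z' pi = y' 0 * z 0 - y 0 * z' 0"
      using \<sigma> by (auto simp: quasi_bc_def)
  qed (auto simp: quasi_bc_def)
qed

theorem theorem4:
  fixes a :: complex
  shows "(0 < cmod a \<and> cmod a \<le> 8 / sqrt 6 \<longrightarrow>
            (\<forall>\<mu>. eigenvalue (A_op a) \<mu> \<longrightarrow> simple_eigenvalue (A_op a) \<mu>) \<and>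
            (\<forall>\<mu>. eigenvalue (D_op a) \<mu> \<longrightarrow> simple_eigenvalue (D_op a) \<mu>))
       \<and> (0 < cmod a \<and> cmod a \<le> 4 / 3 \<longrightarrow>
            (\<forall>\<mu>. eigenvalue (P_op a) \<mu> \<longrightarrow> simple_eigenvalue (P_op a) \<mu>) \<and>
            (\<forall>\<mu>. eigenvalue (N_op a) \<mu> \<longrightarrow> simple_eigenvalue (N_op a) \<mu>))"
proof -
  have "periodic_bc = quasi_bc 1" "antiperiodic_bc = quasi_bc (- 1)"
    by (simp_all add: fun_eq_iff periodic_bc_def antiperiodic_bc_def quasi_bc_def)
  then show ?thesis
    using quasi_simple[of a 1] quasi_simple[of a "- 1"] dirichlet_simple[of a] neumann_simple[of a]
    unfolding P_op_def A_op_def by auto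
qed

end
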